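(* Let $n\ge5$, $m\ge1$, and suppose $u=(u_1,\dots,u_m)$ with $u_i(x)=r^{-\frac{4}{p-1}}\psi_i(\theta)$, $r=|x|$, $\theta=x/|x|$, $\psi_i$ smooth on $\mathbb{S}^{n-1}$, is a stable solution of $\Delta^2u_i=|u|^{p-1}u_i$ in $\mathbb{R}^n\setminus\{0\}$, $i=1,\dots,m$. If $\frac{n+4}{n-4}<p<\bar p_c(n)$, where $\bar p_c(n)=\infty$ for $n\le12$ and $$\bar p_c(n)=\frac{n+2-\sqrt{n^2+4-n\sqrt{n^2-8n+32}}}{n-6-\sqrt{n^2+4-n\sqrt{n^2-8n+32}}}\quad\text{for }n\ge13,$$ then each $\psi_i$ is identically zero.
   Context: $|u|=(\sum_iu_i^2)^{1/2}$. Stable means: $\sum_i\int|u|^{p-1}\phi_i^2+(p-1)\sum_{i,j}\int|u|^{p-3}u_iu_j\phi_i\phi_j\le\sum_i\int|\Delta\phi_i|^2$ for all $\phi_i\in C_c^\infty(\mathbb{R}^n\setminus\{0\})$. *)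

theory Defs
  imports "HOL-Analysis.Analysis" "HOL-Library.Extended_Real"
begin

definition partial :: "'n::finite \<Rightarrow> (real^'n \<Rightarrow> real) \<Rightarrow> real^'n \<Rightarrow> real" where
  "partial i f x = deriv (\<lambda>t. f (x + t *\<^sub>R axis i 1)) 0"

fun iter_partial :: "'n::finite list \<Rightarrow> (real^'n \<Rightarrow> real) \<Rightarrow> real^'n \<Rightarrow> real" where
  "iter_partial [] f = f"
| "iter_partial (i # is) f = partial i (iter_partial is f)"

definition smooth_on :: "(real^'n::finite) set \<Rightarrow> (real^'n \<Rightarrow> real) \<Rightarrow> bool" where
  "smooth_on S f \<longleftrightarrow> open S \<and>
     (\<forall>is. continuous_on S (iter_partial is f) \<and>
        (\<forall>x\<in>S. \<forall>i. (\<lambda>t. iter_partial is f (x + t *\<^sub>R axis i 1)) differentiable (at 0)))"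

definition laplacian :: "(real^'n::finite \<Rightarrow> real) \<Rightarrow> real^'n \<Rightarrow> real" where
  "laplacian f x = (\<Sum>i\<in>UNIV. partial i (partial i f) x)"

definition bilaplacian :: "(real^'n::finite \<Rightarrow> real) \<Rightarrow> real^'n \<Rightarrow> real" where
  "bilaplacian f = laplacian (laplacian f)"

definition cc_smooth_punctured :: "(real^'n::finite \<Rightarrow> real) \<Rightarrow> bool" where
  "cc_smooth_punctured \<phi> \<longleftrightarrow> smooth_on UNIV \<phi> \<and>
     compact (closure {x. \<phi> x \<noteq> 0}) \<and> 0 \<notin> closure {x. \<phi> x \<noteq> 0}"

text \<open>Smoothness of a function on the unit sphere, via its 0-homogeneous extension.\<close>
definition smooth_on_sphere :: "(real^'n::finite \<Rightarrow> real) \<Rightarrow> bool" where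
  "smooth_on_sphere \<psi> \<longleftrightarrow> smooth_on (-{0}) (\<lambda>x. \<psi> ((1 / norm x) *\<^sub>R x))"

definition vnorm :: "nat \<Rightarrow> (nat \<Rightarrow> 'a \<Rightarrow> real) \<Rightarrow> 'a \<Rightarrow> real" where
  "vnorm m u x = sqrt (\<Sum>i<m. (u i x)^2)"

definition is_solution :: "nat \<Rightarrow> real \<Rightarrow> (nat \<Rightarrow> real^'n::finite \<Rightarrow> real) \<Rightarrow> bool" where
  "is_solution m p u \<longleftrightarrow> (\<forall>i<m. \<forall>x. x \<noteq> 0 \<longrightarrow>
      bilaplacian (u i) x = vnorm m u x powr (p - 1) * u i x)"

definition is_stable :: "nat \<Rightarrow> real \<Rightarrow> (nat \<Rightarrow> real^'n::finite \<Rightarrow> real) \<Rightarrow> bool" where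
  "is_stable m p u \<longleftrightarrow> (\<forall>\<phi> :: nat \<Rightarrow> real^'n \<Rightarrow> real. (\<forall>i<m. cc_smooth_punctured (\<phi> i)) \<longrightarrow>
      (\<Sum>i<m. LINT x|lborel. vnorm m u x powr (p - 1) * (\<phi> i x)^2)
      + (p - 1) * (\<Sum>i<m. \<Sum>j<m. LINT x|lborel.
            vnorm m u x powr (p - 3) * u i x * u j x * \<phi> i x * \<phi> j x)
      \<le> (\<Sum>i<m. LINT x|lborel. (laplacian (\<phi> i) x)^2))"

definition pc_bar :: "nat \<Rightarrow> ereal" where
  "pc_bar n = (if n \<le> 12 then \<infinity> else
     (let s = sqrt (real n ^ 2 + 4 - real n * sqrt (real n ^ 2 - 8 * real n + 32))
      in ereal ((real n + 2 - s) / (real n - 6 - s))))"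

end

theory Submission
  imports Defs
begin

text \<open>
  Extend \<open>\<psi>\<^sub>i\<close> to a 0-homogeneous \<open>f\<^sub>i\<close> on the punctured space and put \<open>T f = |x|\<^sup>2 \<Delta> f\<close>, which plays the
  role of the spherical Laplacian. The equation becomes \<open>(T - b)(T - a) f\<^sub>i = |f|\<^sup>p\<^sup>-\<^sup>1 f\<^sub>i\<close> with
  \<open>\<alpha> = 4/(p-1)\<close>, \<open>a = \<alpha>(n-2-\<alpha>)\<close>, \<open>b = (\<alpha>+2)(n-4-\<alpha>)\<close>. Testing stability with
  \<open>|x|\<^sup>-\<^sup>(\<^sup>n\<^sup>-\<^sup>4\<^sup>)\<^sup>/\<^sup>2 \<eta>(|x|\<^sup>2) f\<^sub>i\<close> and integrating by parts against the radial weight \<open>|x|\<^sup>-\<^sup>n \<eta>\<^sup>2\<close> gives,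
  with \<open>A = n(n-4)/4\<close>,
  \<open>(p-1)\<integral>(Tf)\<^sup>2 + (p(a+b) - 2A)\<integral>(-f Tf) + (pab - A\<^sup>2)\<integral>f\<^sup>2 \<le> error\<close>.
  In the given range of \<open>p\<close> all three coefficients are nonnegative and the last one is positive. As the plateau of \<open>\<eta>\<close> grows,
  the error, supported in two collars, stays bounded by homogeneity, whereas \<open>\<integral>|x|\<^sup>-\<^sup>n \<eta>\<^sup>2 f\<^sup>2\<close> grows
  linearly in the logarithmic length of the plateau unless \<open>f = 0\<close>. Working with cutoffs in the whole
  space avoids polar coordinates and integration on the sphere.
\<close>

subsection \<open>A smooth step function\<close>

text \<open>The number \<open>A^2\<close> = n^2 (n-4)^2 / 16 is the best constant of the
  Hardy-Rellich inequality, and |x|^(-(n-4)/2) is its virtual extremal: it fails to be admissible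
  only by a logarithmic divergence. This explains the test function, and it makes
  \<open>p * a * b > A^2\<close> the Joseph-Lundgren condition, that is, instability of the singular
  power solution. The equation is used only after testing it with f_i, which trades the nonlinear
  integral in the stability inequality for quadratic ones; no pointwise information on |f| is
  needed. A radial weight survives every integration by parts because its gradient is parallel to x,
  and x . grad f = 0 for 0-homogeneous f. The obstacle is that smoothness is given through iterated
  partial derivatives, whereas x . grad f = 0 concerns a direction that is not an axis. The calculus
  of smooth functions is therefore built up to total differentiability.\<close>

text \<open>An existential chain of derivative functions, rather than iterated \<open>deriv\<close>:
  closure proofs supply the next derivative explicitly and induct on the order.\<close>

primrec diff_n :: "nat \<Rightarrow> real set \<Rightarrow> (real \<Rightarrow> real) \<Rightarrow> bool" where
  "diff_n 0 T f \<longleftrightarrow> True"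
| "diff_n (Suc k) T f \<longleftrightarrow>
     (\<exists>f'. (\<forall>t\<in>T. (f has_real_derivative f' t) (at t)) \<and> diff_n k T f')"

lemma diff_n_Suc_imp: "diff_n (Suc k) T f \<Longrightarrow> diff_n k T f"
proof (induction k arbitrary: f)
  case (Suc k)
  then obtain f' where f': "\<forall>t\<in>T. (f has_real_derivative f' t) (at t)" "diff_n (Suc k) T f'"
    by (subst (asm) diff_n.simps) auto
  then show ?case using Suc.IH by auto
qed simp

lemma diff_n_const: "diff_n k T (\<lambda>_. c)"
proof (induction k arbitrary: c)
  case (Suc k)
  have "\<forall>t\<in>T. ((\<lambda>_. c) has_real_derivative 0) (at t)" by simp
  then show ?case using Suc[of 0] by (auto simp: intro!: exI[of _ "\<lambda>_. 0"])
qed simp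

lemma diff_n_add: "diff_n k T f \<Longrightarrow> diff_n k T g \<Longrightarrow> diff_n k T (\<lambda>t. f t + g t)"
proof (induction k arbitrary: f g)
  case (Suc k)
  then obtain f' g' where
    "\<forall>t\<in>T. (f has_real_derivative f' t) (at t)" "diff_n k T f'"
    "\<forall>t\<in>T. (g has_real_derivative g' t) (at t)" "diff_n k T g'" by auto
  then show ?case using Suc.IH[of f' g']
    by (auto intro!: exI[of _ "\<lambda>t. f' t + g' t"] DERIV_add)
qed simp

lemma diff_n_mult: "diff_n k T f \<Longrightarrow> diff_n k T g \<Longrightarrow> diff_n k T (\<lambda>t. f t * g t)"
proof (induction k arbitrary: f g)
  case (Suc k)
  from Suc.prems obtain f' g' where
    d: "\<forall>t\<in>T. (f has_real_derivative f' t) (at t)" "diff_n k T f'"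
    "\<forall>t\<in>T. (g has_real_derivative g' t) (at t)" "diff_n k T g'" by auto
  have "diff_n k T (\<lambda>t. f' t * g t + g' t * f t)"
    by (intro diff_n_add Suc.IH d diff_n_Suc_imp[OF Suc.prems(1)] diff_n_Suc_imp[OF Suc.prems(2)])
  then show ?case using d
    by (auto intro!: exI[of _ "\<lambda>t. f' t * g t + g' t * f t"] DERIV_mult)
qed simp

lemma diff_n_affine: "diff_n k UNIV f \<Longrightarrow> diff_n k UNIV (\<lambda>t. f (a * t + b))"
proof (induction k arbitrary: f)
  case (Suc k)
  then obtain f' where d: "\<And>t. (f has_real_derivative f' t) (at t)" "diff_n k UNIV f'" by auto
  have "((\<lambda>t. f (a * t + b)) has_real_derivative f' (a * t + b) * a) (at t)" for t
    by (rule DERIV_chain2[of f]) (auto intro!: derivative_eq_intros d)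
  moreover have "diff_n k UNIV (\<lambda>t. f' (a * t + b) * a)"
    using diff_n_mult[OF Suc.IH[OF d(2)] diff_n_const[of k UNIV a]] .
  ultimately show ?case by (auto intro!: exI[of _ "\<lambda>t. f' (a * t + b) * a"])
qed simp

lemma diff_n_inverse:
  "diff_n k T f \<Longrightarrow> (\<And>t. t \<in> T \<Longrightarrow> f t \<noteq> 0) \<Longrightarrow> diff_n k T (\<lambda>t. inverse (f t))"
proof (induction k arbitrary: f)
  case (Suc k)
  from Suc.prems obtain f' where d: "\<And>t. t \<in> T \<Longrightarrow> (f has_real_derivative f' t) (at t)" "diff_n k T f'" by auto
  have i: "diff_n k T (\<lambda>t. inverse (f t))" by (intro Suc.IH diff_n_Suc_imp[OF Suc.prems(1)] Suc.prems(2))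
  have "((\<lambda>t. inverse (f t)) has_real_derivative - 1 * (f' t * (inverse (f t) * inverse (f t)))) (at t)" if "t \<in> T" for t
    using d(1)[OF that] Suc.prems(2)[OF that]
    by (auto intro!: derivative_eq_intros simp: power2_eq_square field_simps)
  moreover have "diff_n k T (\<lambda>t. - 1 * (f' t * (inverse (f t) * inverse (f t))))"
    by (intro diff_n_mult diff_n_const d i)
  ultimately show ?case
    by (auto intro!: exI[of _ "\<lambda>t. - 1 * (f' t * (inverse (f t) * inverse (f t)))"])
qed simp

lemma diff_n_powr: "diff_n k {0<..} (\<lambda>t. t powr a)"
proof (induction k arbitrary: a)
  case (Suc k)
  have "\<forall>t\<in>{0<..}. ((\<lambda>t. t powr a) has_real_derivative a * t powr (a - 1)) (at t)"
    by (auto intro!: derivative_eq_intros)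
  moreover have "diff_n k {0<..} (\<lambda>t. a * t powr (a - 1))"
    by (intro diff_n_mult diff_n_const Suc)
  ultimately show ?case by auto
qed simp

lemma diff_n_subset: "diff_n k T f \<Longrightarrow> T' \<subseteq> T \<Longrightarrow> diff_n k T' f"
proof (induction k arbitrary: f)
  case (Suc k)
  then obtain f' where "\<forall>t\<in>T. (f has_real_derivative f' t) (at t)" "diff_n k T f'" by auto
  then have "\<forall>t\<in>T'. (f has_real_derivative f' t) (at t)" "diff_n k T' f'"
    using Suc.prems(2) Suc.IH[of f'] by auto
  then show ?case by auto
qed simp

lemma diff_n_ident: "diff_n k T (\<lambda>t. t)"
proof (cases k)
  case (Suc l)
  have "\<forall>t\<in>T. ((\<lambda>t. t) has_real_derivative 1) (at t)" by auto
  then show ?thesis unfolding Suc using diff_n_const[of l T 1] by (auto intro!: exI[of _ "\<lambda>_. 1"])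
qed simp

lemma diff_n_continuous: "diff_n (Suc k) T f \<Longrightarrow> continuous_on T f"
  by (auto simp: continuous_on_eq_continuous_at intro!: continuous_at_imp_continuous_on dest: DERIV_isCont)

lemma diff_n_UNIV_continuous:
  "(\<And>k. diff_n k UNIV \<eta>) \<Longrightarrow> continuous_on T \<eta>"
  using diff_n_continuous[of 0 UNIV \<eta>] continuous_on_subset by blast

text \<open>The polynomial makes the family closed under differentiation; the function wanted in the
  end is \<open>flat 1\<close>, that is exp(-1/t).\<close>

definition flat :: "real poly \<Rightarrow> real \<Rightarrow> real" where
  "flat P t = (if t > 0 then poly P (1 / t) * exp (- (1 / t)) else 0)"

lemma poly_times_exp_tendsto_0: "((\<lambda>y. poly P y * exp (- y)) \<longlongrightarrow> (0::real)) at_top"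
proof -
  have "((\<lambda>y. \<Sum>i\<le>degree P. coeff P i * (y ^ i / exp y)) \<longlongrightarrow> (\<Sum>i\<le>degree P. coeff P i * 0)) at_top"
    by (intro tendsto_sum tendsto_mult tendsto_const tendsto_power_div_exp_0)
  then show ?thesis
    by (simp add: poly_altdef sum_distrib_right sum_divide_distrib[symmetric] exp_minus divide_inverse mult.assoc)
qed

text \<open>With y = 1/t one has d/dt = -y^2 d/dy, which sends P(y) e^(-y) to y^2 (P - P')(y)
  e^(-y), again of the same form. Only t = 0 needs a limit.\<close>

lemma flat_deriv:
  "(flat P has_real_derivative flat (monom 1 2 * (P - pderiv P)) t) (at t)"
proof -
  consider "t > 0" | "t < 0" | "t = 0" by linarith
  then show ?thesis
  proof cases
    case 1
    have inv: "((\<lambda>s. 1 / s) has_real_derivative - (1 / t * (1 / t))) (at t)"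
      using 1 by (auto intro!: derivative_eq_intros)
    have "((\<lambda>s. poly P (1 / s) * exp (- (1 / s))) has_real_derivative
        (poly (pderiv P) (1 / t) * - (1 / t * (1 / t))) * exp (- (1 / t))
        + exp (- (1 / t)) * (- (- (1 / t * (1 / t)))) * poly P (1 / t)) (at t)"
      by (intro DERIV_mult DERIV_chain2[OF poly_DERIV] DERIV_chain2[OF DERIV_exp] DERIV_minus inv)
    also have "(poly (pderiv P) (1 / t) * - (1 / t * (1 / t))) * exp (- (1 / t))
        + exp (- (1 / t)) * (- (- (1 / t * (1 / t)))) * poly P (1 / t)
        = flat (monom 1 2 * (P - pderiv P)) t"
      using 1 by (simp add: flat_def poly_monom power2_eq_square algebra_simps)
    finally have "((\<lambda>s. poly P (1 / s) * exp (- (1 / s))) has_real_derivative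
        flat (monom 1 2 * (P - pderiv P)) t) (at t)" .
    then show ?thesis
      by (rule has_field_derivative_transform_within_open[where S="{0<..}"])
        (use 1 in \<open>auto simp: flat_def\<close>)
  next
    case 2
    have "((\<lambda>s::real. 0::real) has_real_derivative flat (monom 1 2 * (P - pderiv P)) t) (at t)"
      using 2 by (simp add: flat_def)
    then show ?thesis
      by (rule has_field_derivative_transform_within_open[where S="{..<0}"])
        (use 2 in \<open>auto simp: flat_def\<close>)
  next
    case 3
    \<comment> \<open>With y = 1/h the right difference quotient at 0 is y P(y) e^(-y), and
      \<open>pCons 0 P\<close> is the polynomial y P(y).\<close>
    have "((\<lambda>h. poly (pCons 0 P) (inverse h) * exp (- inverse h)) \<longlongrightarrow> 0) (at_right 0)"
      by (rule filterlim_compose[OF poly_times_exp_tendsto_0 filterlim_inverse_at_top_right])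
    moreover have "\<forall>\<^sub>F h in at_right 0. poly (pCons 0 P) (inverse h) * exp (- inverse h) = flat P h / h"
      by (auto simp: flat_def eventually_at_filter field_simps)
    ultimately have r: "((\<lambda>h. flat P h / h) \<longlongrightarrow> 0) (at_right 0)"
      by (rule Lim_transform_eventually)
    have "\<forall>\<^sub>F h in at_left 0. 0 = flat P h / h"
      by (auto simp: flat_def eventually_at_filter)
    then have l: "((\<lambda>h. flat P h / h) \<longlongrightarrow> 0) (at_left 0)"
      by (rule Lim_transform_eventually[OF tendsto_const])
    from l r have "((\<lambda>h. flat P h / h) \<longlongrightarrow> 0) (at 0)" by (simp add: filterlim_split_at_real)
    then show ?thesis using 3 by (simp add: has_field_derivative_iff flat_def)
  qed
qed

lemma diff_n_flat: "diff_n k UNIV (flat P)"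
  using flat_deriv by (induction k arbitrary: P) (simp, (subst diff_n.simps, blast))

lemma flat_1: "flat 1 t \<ge> 0" "t > 0 \<Longrightarrow> flat 1 t > 0" "t \<le> 0 \<Longrightarrow> flat 1 t = 0"
  by (auto simp: flat_def)

text \<open>Two derivatives are named because the Laplacian of a cutoff involves exactly these;
  continuity of \<open>\<sigma>''\<close> later serves to bound the cutoff terms.\<close>

definition smooth_step :: "(real \<Rightarrow> real) \<Rightarrow> (real \<Rightarrow> real) \<Rightarrow> (real \<Rightarrow> real) \<Rightarrow> bool" where
  "smooth_step \<sigma> \<sigma>' \<sigma>'' \<longleftrightarrow> (\<forall>k. diff_n k UNIV \<sigma>) \<and>
    (\<forall>t. (\<sigma> has_real_derivative \<sigma>' t) (at t)) \<and> (\<forall>t. (\<sigma>' has_real_derivative \<sigma>'' t) (at t)) \<and>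
    continuous_on UNIV \<sigma>'' \<and> (\<forall>t\<le>1. \<sigma> t = 0) \<and> (\<forall>t\<ge>2. \<sigma> t = 1) \<and> (\<forall>t. 0 \<le> \<sigma> t \<and> \<sigma> t \<le> 1) \<and>
    (\<forall>t. t \<notin> {1..2} \<longrightarrow> \<sigma>' t = 0 \<and> \<sigma>'' t = 0)"

lemma smooth_stepD:
  assumes "smooth_step \<sigma> \<sigma>' \<sigma>''"
  shows "\<And>k. diff_n k UNIV \<sigma>"
    "\<And>t. (\<sigma> has_real_derivative \<sigma>' t) (at t)" "\<And>t. (\<sigma>' has_real_derivative \<sigma>'' t) (at t)"
    "continuous_on UNIV \<sigma>''"
    "\<And>t. t \<le> 1 \<Longrightarrow> \<sigma> t = 0" "\<And>t. t \<ge> 2 \<Longrightarrow> \<sigma> t = 1" "\<And>t. 0 \<le> \<sigma> t \<and> \<sigma> t \<le> 1"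
    "\<And>t. t \<notin> {1..2} \<Longrightarrow> \<sigma>' t = 0 \<and> \<sigma>'' t = 0"
  using assms unfolding smooth_step_def by blast+

lemma smooth_step_exists: "\<exists>\<sigma> \<sigma>' \<sigma>''. smooth_step \<sigma> \<sigma>' \<sigma>''"
proof -
  \<comment> \<open>The quotient g(t-1) / (g(t-1) + g(2-t)) with g = \<open>flat 1\<close>. The
    arguments are spelled \<open>a * t + b\<close> to match \<open>diff_n_affine\<close>.\<close>
  define \<sigma> where "\<sigma> t = flat 1 (1 * t + (-1)) * inverse (flat 1 (1 * t + (-1)) + flat 1 ((-1) * t + 2))" for t :: real
  have pos: "flat 1 (1 * t + (-1)) + flat 1 ((-1) * t + 2) > 0" for t :: real
  proof (cases "t > 1")
    case True
    then show ?thesis by (intro add_pos_nonneg[OF flat_1(2) flat_1(1)]) simp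
  next
    case False
    then show ?thesis by (intro add_nonneg_pos[OF flat_1(1) flat_1(2)]) simp
  qed
  have dn: "diff_n k UNIV \<sigma>" for k
    unfolding \<sigma>_def
    by (intro diff_n_mult diff_n_inverse diff_n_add diff_n_affine diff_n_flat less_imp_neq[OF pos, symmetric])
  from dn[of 3] obtain \<sigma>' \<sigma>'' \<sigma>''' where
    d: "\<And>t. (\<sigma> has_real_derivative \<sigma>' t) (at t)" "\<And>t. (\<sigma>' has_real_derivative \<sigma>'' t) (at t)"
       "\<And>t. (\<sigma>'' has_real_derivative \<sigma>''' t) (at t)"
    unfolding numeral_3_eq_3 diff_n.simps by blast
  have z: "\<sigma> t = 0" if "t \<le> 1" for t using that by (simp add: \<sigma>_def flat_1(3))
  have o: "\<sigma> t = 1" if "t \<ge> 2" for t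
    using that flat_1(2)[of "t - 1"] by (simp add: \<sigma>_def flat_1(3))
  \<comment> \<open>A function that is constant on an open set has zero derivative there; applied
    first to \<open>\<sigma>\<close> and then to \<open>\<sigma>'\<close>.\<close>
  have loc: "D t = 0" if "open U" "t \<in> U" "\<And>s. s \<in> U \<Longrightarrow> g s = c" "\<And>t. (g has_real_derivative D t) (at t)"
    for D g U and c t :: real
  proof -
    have "((\<lambda>_. c) has_real_derivative 0) (at t)" by simp
    then have "(g has_real_derivative 0) (at t)"
      by (rule has_field_derivative_transform_within_open[where S=U]) (use that in auto)
    then show ?thesis using that(4) DERIV_unique by blast
  qed
  have z': "\<sigma>' t = 0" if "t < 1" for t
    by (rule loc[where U="{..<1}" and g=\<sigma> and c=0]) (use that d z in auto)
  have o': "\<sigma>' t = 0" if "t > 2" for t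
    by (rule loc[where U="{2<..}" and g=\<sigma> and c=1]) (use that d o in auto)
  have z'': "\<sigma>'' t = 0" if "t < 1" for t
    by (rule loc[where U="{..<1}" and g=\<sigma>' and c=0]) (use that d z' in auto)
  have o'': "\<sigma>'' t = 0" if "t > 2" for t
    by (rule loc[where U="{2<..}" and g=\<sigma>' and c=0]) (use that d o' in auto)
  have "smooth_step \<sigma> \<sigma>' \<sigma>''" unfolding smooth_step_def
  proof (intro conjI allI impI)
    show "continuous_on UNIV \<sigma>''"
      by (rule DERIV_continuous_on) (use d in blast)
    show "0 \<le> \<sigma> t" "\<sigma> t \<le> 1" for t
      using pos[of t] flat_1(1)[of "1 * t + (-1)"] flat_1(1)[of "(-1) * t + 2"]
      by (simp_all add: \<sigma>_def field_simps)
    show "\<sigma>' t = 0" "\<sigma>'' t = 0" if "t \<notin> {1..2}" for t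
      using that z' o' z'' o'' by (auto simp: not_le)
  qed (use dn d z o in auto)
  then show ?thesis by blast
qed

subsection \<open>Calculus of coordinatewise smooth functions\<close>

abbreviation has_partial :: "(real^'n::finite \<Rightarrow> real) \<Rightarrow> 'n \<Rightarrow> real \<Rightarrow> real^'n \<Rightarrow> bool" where
  "has_partial f i D x \<equiv> ((\<lambda>t. f (x + t *\<^sub>R axis i 1)) has_real_derivative D) (at 0)"

lemma has_partial_imp: "has_partial f i D x \<Longrightarrow> partial i f x = D"
  unfolding partial_def by (rule DERIV_imp_deriv)

lemma has_partial_cong:
  fixes f g :: "real^'n::finite \<Rightarrow> real"
  assumes "open S" "x \<in> S" "\<And>y. y \<in> S \<Longrightarrow> f y = g y" "has_partial f i D x"
  shows "has_partial g i D x"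
proof -
  have "open ((\<lambda>t. x + t *\<^sub>R axis i 1) -` S)"
    by (rule open_vimage[OF \<open>open S\<close>]) (intro continuous_intros)
  then show ?thesis
    using assms by (elim has_field_derivative_transform_within_open) auto
qed

text \<open>\<open>deriv\<close> is a choice operator, so it suffices that both functions have the
  same candidate derivatives, also at points where there are none.\<close>

lemma partial_cong:
  fixes f g :: "real^'n::finite \<Rightarrow> real"
  assumes "open S" "x \<in> S" "\<And>y. y \<in> S \<Longrightarrow> f y = g y"
  shows "partial i f x = partial i g x"
proof -
  have "has_partial f i D x \<longleftrightarrow> has_partial g i D x" for D
    using assms has_partial_cong[of S x f g i D] has_partial_cong[of S x g f i D] by auto
  then show ?thesis unfolding partial_def deriv_def by simp
qed

lemma laplacian_cong:
  fixes f g :: "real^'n::finite \<Rightarrow> real"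
  assumes "open S" "x \<in> S" "\<And>y. y \<in> S \<Longrightarrow> f y = g y"
  shows "laplacian f x = laplacian g x"
  unfolding laplacian_def using assms
  by (intro sum.cong refl partial_cong[of S]) (auto intro: partial_cong)

definition is_grad :: "(real^'n::finite) set \<Rightarrow> (real^'n \<Rightarrow> real) \<Rightarrow> ('n \<Rightarrow> real^'n \<Rightarrow> real) \<Rightarrow> bool" where
  "is_grad S f g \<longleftrightarrow> (\<forall>i. \<forall>x\<in>S. has_partial f i (g i x) x)"

lemma is_gradD: "is_grad S f g \<Longrightarrow> x \<in> S \<Longrightarrow> has_partial f i (g i x) x"
  by (simp add: is_grad_def)

text \<open>A finite-order form of \<open>smooth_on\<close> with the gradient existentially
  quantified. Products and compositions go by induction on the order instead of by formulas for
  \<open>iter_partial\<close> along arbitrary lists; \<open>smooth_on_iff_Cn\<close> translates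
  back.\<close>

primrec Cn :: "nat \<Rightarrow> (real^'n::finite) set \<Rightarrow> (real^'n \<Rightarrow> real) \<Rightarrow> bool" where
  "Cn 0 S f \<longleftrightarrow> continuous_on S f"
| "Cn (Suc k) S f \<longleftrightarrow> continuous_on S f \<and>
     (\<exists>g. is_grad S f g \<and> (\<forall>i. Cn k S (g i)))"

lemma Cn_SucI:
  "continuous_on S f \<Longrightarrow> (\<And>i x. x \<in> S \<Longrightarrow> has_partial f i (g i x) x) \<Longrightarrow>
   (\<And>i. Cn k S (g i)) \<Longrightarrow> Cn (Suc k) S f"
  by (auto simp: is_grad_def)

lemma Cn_SucE:
  assumes "Cn (Suc k) S f"
  obtains g where "continuous_on S f" "is_grad S f g" "\<And>i. Cn k S (g i)"
  using assms by auto

declare Cn.simps(2) [simp del]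

lemma Cn_continuous: "Cn k S f \<Longrightarrow> continuous_on S f"
  by (cases k) (auto simp: Cn.simps(2))

lemma Cn_Suc_imp: "Cn (Suc k) S f \<Longrightarrow> Cn k S f"
proof (induction k arbitrary: f)
  case (Suc k)
  from Suc.prems obtain g where g: "continuous_on S f" "is_grad S f g" "\<And>i. Cn (Suc k) S (g i)"
    by (rule Cn_SucE) blast
  have "\<forall>i. Cn k S (g i)" using Suc.IH g(3) by blast
  then show ?case unfolding Cn.simps(2) using g(1,2) by blast
qed (simp add: Cn.simps(2))

lemma Cn_cong:
  assumes "open S" "\<And>x. x \<in> S \<Longrightarrow> f x = f' x" "Cn k S f"
  shows "Cn k S f'"
proof (cases k)
  case 0
  then show ?thesis using assms continuous_on_cong[of S S f f'] by simp
next
  case (Suc j)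
  with assms(3) have "Cn (Suc j) S f" by simp
  then obtain g where g: "continuous_on S f" "is_grad S f g" "\<And>i. Cn j S (g i)" by (rule Cn_SucE) blast
  have "continuous_on S f'" using g(1) assms continuous_on_cong[of S S f f'] by simp
  then show ?thesis unfolding Suc
    by (rule Cn_SucI[of _ _ g]) (rule has_partial_cong[OF assms(1) _ assms(2)], assumption, assumption, rule is_gradD[OF g(2)], assumption, rule g(3))
qed

lemma Cn_const: "Cn k S (\<lambda>_. c)"
proof (induction k arbitrary: c)
  case (Suc k)
  show ?case by (rule Cn_SucI[of _ _ "\<lambda>_ _. 0"]) (auto intro: Suc)
qed simp

lemma Cn_add: "Cn k S f \<Longrightarrow> Cn k S g \<Longrightarrow> Cn k S (\<lambda>x. f x + g x)"
proof (induction k arbitrary: f g)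
  case (Suc k)
  obtain f' where f: "continuous_on S f" "is_grad S f f'" "\<And>i. Cn k S (f' i)"
    using Suc.prems(1) by (rule Cn_SucE) blast
  obtain g' where g: "continuous_on S g" "is_grad S g g'" "\<And>i. Cn k S (g' i)"
    using Suc.prems(2) by (rule Cn_SucE) blast
  show ?case
  proof (rule Cn_SucI[of _ _ "\<lambda>i x. f' i x + g' i x"])
    show "continuous_on S (\<lambda>x. f x + g x)" by (intro continuous_on_add f g)
    show "has_partial (\<lambda>x. f x + g x) i (f' i x + g' i x) x" if "x \<in> S" for i x
      using DERIV_add[OF is_gradD[OF f(2) that] is_gradD[OF g(2) that]] .
    show "Cn k S (\<lambda>x. f' i x + g' i x)" for i by (intro Suc.IH f g)
  qed
qed (auto intro: continuous_on_add)

lemma Cn_mult: "Cn k S f \<Longrightarrow> Cn k S g \<Longrightarrow> Cn k S (\<lambda>x. f x * g x)"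
proof (induction k arbitrary: f g)
  case (Suc k)
  obtain f' where f: "continuous_on S f" "is_grad S f f'" "\<And>i. Cn k S (f' i)"
    using Suc.prems(1) by (rule Cn_SucE) blast
  obtain g' where g: "continuous_on S g" "is_grad S g g'" "\<And>i. Cn k S (g' i)"
    using Suc.prems(2) by (rule Cn_SucE) blast
  show ?case
  proof (rule Cn_SucI[of _ _ "\<lambda>i x. f' i x * g x + g' i x * f x"])
    show "continuous_on S (\<lambda>x. f x * g x)" by (intro continuous_on_mult f g)
    show "has_partial (\<lambda>x. f x * g x) i (f' i x * g x + g' i x * f x) x" if "x \<in> S" for i x
      using DERIV_mult[OF is_gradD[OF f(2) that] is_gradD[OF g(2) that]] by simp
    show "Cn k S (\<lambda>x. f' i x * g x + g' i x * f x)" for i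
      by (intro Cn_add Suc.IH f g Cn_Suc_imp[OF Suc.prems(1)] Cn_Suc_imp[OF Suc.prems(2)])
  qed
qed (auto intro: continuous_on_mult)

text \<open>The outer function has order \<open>Suc k\<close> because \<open>diff_n\<close> leaves
  its top derivative without continuity.\<close>

lemma Cn_compose:
  "diff_n (Suc k) T h \<Longrightarrow> (\<And>x. x \<in> S \<Longrightarrow> f x \<in> T) \<Longrightarrow> Cn k S f \<Longrightarrow> Cn k S (\<lambda>x. h (f x))"
proof (induction k arbitrary: h)
  case 0
  have "continuous_on T h" using 0(1) by (rule diff_n_continuous)
  then have "continuous_on S (\<lambda>x. h (f x))"
    by (rule continuous_on_compose2) (use 0 in auto)
  then show ?case by simp
next
  case (Suc k)
  obtain f' where f: "continuous_on S f" "is_grad S f f'" "\<And>i. Cn k S (f' i)"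
    using Suc.prems(3) by (rule Cn_SucE) blast
  from Suc.prems(1) obtain h' where h: "\<And>t. t \<in> T \<Longrightarrow> (h has_real_derivative h' t) (at t)" "diff_n (Suc k) T h'"
    by (subst (asm) diff_n.simps) blast
  have "continuous_on T h" using Suc.prems(1) by (rule diff_n_continuous)
  show ?case
  proof (rule Cn_SucI[of _ _ "\<lambda>i x. h' (f x) * f' i x"])
    show "continuous_on S (\<lambda>x. h (f x))"
      by (rule continuous_on_compose2[OF \<open>continuous_on T h\<close> f(1)]) (use Suc.prems in auto)
    show "has_partial (\<lambda>x. h (f x)) i (h' (f x) * f' i x) x" if "x \<in> S" for i x
      using DERIV_chain2[of h "h' (f x)" "\<lambda>t. f (x + t *\<^sub>R axis i 1)" 0 "f' i x" UNIV]
        h(1)[OF Suc.prems(2)[OF that]] is_gradD[OF f(2) that] by simp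
    show "Cn k S (\<lambda>x. h' (f x) * f' i x)" for i
      by (rule Cn_mult[OF Suc.IH[OF h(2) Suc.prems(2) Cn_Suc_imp[OF Suc.prems(3)]] f(3)])
  qed
qed

lemma smooth_on_imp_Cn: "smooth_on S f \<Longrightarrow> Cn k S (iter_partial is f)"
proof (induction k arbitrary: "is")
  case (Suc k)
  have d: "has_partial (iter_partial is f) i (iter_partial (i # is) f x) x" if "x \<in> S" for i x
  proof -
    have "(\<lambda>t. iter_partial is f (x + t *\<^sub>R axis i 1)) differentiable (at 0)"
      using Suc.prems that unfolding smooth_on_def by blast
    then show ?thesis unfolding partial_def iter_partial.simps
      by (simp add: DERIV_deriv_iff_real_differentiable)
  qed
  show ?case
    by (rule Cn_SucI[of _ _ "\<lambda>i. iter_partial (i # is) f"])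
      (use Suc.prems in \<open>simp add: smooth_on_def\<close>, rule d, assumption, rule Suc.IH[OF Suc.prems])
qed (simp add: smooth_on_def)

lemma Cn_partial:
  assumes "open S" "Cn (Suc k) S f"
  shows "Cn k S (partial i f)" "x \<in> S \<Longrightarrow> has_partial f i (partial i f x) x"
proof -
  obtain f' where f: "continuous_on S f" "is_grad S f f'" "\<And>i. Cn k S (f' i)"
    using assms(2) by (rule Cn_SucE) blast
  have e: "partial i f x = f' i x" if "x \<in> S" for x using has_partial_imp is_gradD[OF f(2) that] .
  show "Cn k S (partial i f)" by (rule Cn_cong[OF assms(1) _ f(3)[of i]]) (simp add: e)
  show "x \<in> S \<Longrightarrow> has_partial f i (partial i f x) x" using e is_gradD[OF f(2)] by simp
qed

lemma Cn_iter_partial: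
  "open S \<Longrightarrow> Cn (k + length is) S f \<Longrightarrow> Cn k S (iter_partial is f)"
proof (induction "is" arbitrary: k)
  case (Cons i "is")
  then have "Cn (Suc k) S (iter_partial is f)" by simp
  then show ?case using Cn_partial(1)[OF Cons.prems(1)] by simp
qed simp

lemma smooth_on_iff_Cn: "smooth_on S f \<longleftrightarrow> open S \<and> (\<forall>k. Cn k S f)"
proof
  assume "smooth_on S f"
  then show "open S \<and> (\<forall>k. Cn k S f)"
    using smooth_on_imp_Cn[of S f _ "[]"] by (auto simp: smooth_on_def)
next
  assume *: "open S \<and> (\<forall>k. Cn k S f)"
  then have c: "Cn k S (iter_partial is f)" for k "is" by (intro Cn_iter_partial) auto
  have "(\<lambda>t. iter_partial is f (x + t *\<^sub>R axis i 1)) differentiable (at 0)" if "x \<in> S" for i x "is"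
    using Cn_partial(2)[OF conjunct1[OF *] c[of "Suc 0" "is"] that, of i] real_differentiable_def by blast
  then show "smooth_on S f"
    using * Cn_continuous[OF c] by (auto simp: smooth_on_def)
qed

lemma smooth_on_open: "smooth_on S f \<Longrightarrow> open S" by (simp add: smooth_on_def)

lemma smooth_on_continuous: "smooth_on S f \<Longrightarrow> continuous_on S f"
  using Cn_continuous by (auto simp: smooth_on_iff_Cn)

lemma smooth_on_partial: "smooth_on S f \<Longrightarrow> smooth_on S (partial i f)"
  unfolding smooth_on_iff_Cn by (blast intro: Cn_partial(1))

lemma smooth_on_has_partial: "smooth_on S f \<Longrightarrow> x \<in> S \<Longrightarrow> has_partial f i (partial i f x) x"
  using Cn_partial(2) smooth_on_iff_Cn by metis

lemma smooth_on_cong: "smooth_on S f \<Longrightarrow> (\<And>x. x \<in> S \<Longrightarrow> f x = g x) \<Longrightarrow> smooth_on S g"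
  using Cn_cong smooth_on_iff_Cn by metis

lemma smooth_on_const: "open S \<Longrightarrow> smooth_on S (\<lambda>_. c)"
  by (simp add: smooth_on_iff_Cn Cn_const)

lemma smooth_on_add: "smooth_on S f \<Longrightarrow> smooth_on S g \<Longrightarrow> smooth_on S (\<lambda>x. f x + g x)"
  by (simp add: smooth_on_iff_Cn Cn_add)

lemma smooth_on_mult: "smooth_on S f \<Longrightarrow> smooth_on S g \<Longrightarrow> smooth_on S (\<lambda>x. f x * g x)"
  by (simp add: smooth_on_iff_Cn Cn_mult)

lemma smooth_on_diff:
  assumes "smooth_on S f" "smooth_on S g" shows "smooth_on S (\<lambda>x. f x - g x)"
  using smooth_on_add[OF assms(1) smooth_on_mult[OF smooth_on_const[OF smooth_on_open[OF assms(1)], of "-1"] assms(2)]]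
  by simp

lemma smooth_on_sum:
  "open S \<Longrightarrow> (\<And>i. i \<in> I \<Longrightarrow> smooth_on S (f i)) \<Longrightarrow> smooth_on S (\<lambda>x. \<Sum>i\<in>I. f i x)"
  by (induction I rule: infinite_finite_induct) (auto intro: smooth_on_const smooth_on_add)

lemma smooth_on_compose:
  "(\<And>k. diff_n k T h) \<Longrightarrow> smooth_on S f \<Longrightarrow> (\<And>x. x \<in> S \<Longrightarrow> f x \<in> T) \<Longrightarrow> smooth_on S (\<lambda>x. h (f x))"
  using Cn_compose smooth_on_iff_Cn by metis

lemma smooth_on_Un: "smooth_on A f \<Longrightarrow> smooth_on B f \<Longrightarrow> smooth_on (A \<union> B) f"
  unfolding smooth_on_def by (auto intro: continuous_on_open_Un)

lemma smooth_on_laplacian: "smooth_on S f \<Longrightarrow> smooth_on S (laplacian f)"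
  unfolding laplacian_def[abs_def]
  by (intro smooth_on_sum smooth_on_partial) (auto dest: smooth_on_open)

lemma has_partial_component: "has_partial (\<lambda>x. x $ j) i (if j = i then 1 else 0) x"
  by (auto intro!: derivative_eq_intros simp: axis_def)

lemma has_partial_inner: "has_partial (\<lambda>x. x \<bullet> x) i (2 * x $ i) x"
proof -
  have "(\<lambda>t. (x + t *\<^sub>R axis i 1) \<bullet> (x + t *\<^sub>R axis i 1)) = (\<lambda>t. x \<bullet> x + 2 * t * x $ i + t * t)"
    by (auto simp: inner_add_left inner_add_right inner_axis inner_axis' inner_axis_axis algebra_simps)
  then show ?thesis by (auto intro!: derivative_eq_intros)
qed

lemma smooth_on_component: "open S \<Longrightarrow> smooth_on S (\<lambda>x. x $ j)"
proof -
  have "Cn k S (\<lambda>x. x $ j)" for k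
  proof (cases k)
    case (Suc l)
    show ?thesis unfolding Suc
      by (rule Cn_SucI[of _ _ "\<lambda>i x. if j = i then 1 else 0"])
        (use has_partial_component[where j=j] in \<open>auto intro!: Cn_const continuous_intros\<close>)
  qed (auto intro!: continuous_intros)
  then show "open S \<Longrightarrow> ?thesis" by (simp add: smooth_on_iff_Cn)
qed

lemma smooth_on_inner: "open S \<Longrightarrow> smooth_on S (\<lambda>x. x \<bullet> x)"
  unfolding inner_vec_def by (auto intro!: smooth_on_sum smooth_on_mult smooth_on_component)

lemma smooth_on_line_derivative:
  assumes "smooth_on S f" "x + t *\<^sub>R axis i 1 \<in> S"
  shows "((\<lambda>t. f (x + t *\<^sub>R axis i 1)) has_real_derivative partial i f (x + t *\<^sub>R axis i 1)) (at t)"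
proof -
  have "((\<lambda>s. f (x + (s + t) *\<^sub>R axis i 1)) has_real_derivative partial i f (x + t *\<^sub>R axis i 1)) (at 0)"
    using smooth_on_has_partial[OF assms, of i] by (simp add: algebra_simps)
  then show ?thesis
    using DERIV_shift[of "\<lambda>t. f (x + t *\<^sub>R axis i 1)" _ 0 t] by simp
qed

text \<open>Mean value estimate along a coordinate line with a slope \<open>c\<close> subtracted. It
  has two uses: \<open>c\<close> the partial derivative at the base point, for total
  differentiability, and \<open>c = 0\<close>, to dominate difference quotients.\<close>

lemma smooth_on_line_bound:
  assumes f: "smooth_on S f" and sub: "\<And>s. s \<in> closed_segment 0 t \<Longrightarrow> x + s *\<^sub>R axis i 1 \<in> S"
    and B: "\<And>s. s \<in> closed_segment 0 t \<Longrightarrow> \<bar>partial i f (x + s *\<^sub>R axis i 1) - c\<bar> \<le> B"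
  shows "\<bar>f (x + t *\<^sub>R axis i 1) - f x - t * c\<bar> \<le> B * \<bar>t\<bar>"
proof -
  have "norm ((f (x + t *\<^sub>R axis i 1) - t * c) - (f (x + 0 *\<^sub>R axis i 1) - 0 * c)) \<le> B * norm (t - 0)"
  proof (rule field_differentiable_bound[where S="closed_segment 0 t"])
    fix s assume s: "s \<in> closed_segment 0 t"
    have "((\<lambda>s. f (x + s *\<^sub>R axis i 1) - s * c) has_real_derivative
        partial i f (x + s *\<^sub>R axis i 1) - 1 * c) (at s)"
      by (intro DERIV_diff smooth_on_line_derivative[OF f sub[OF s]] DERIV_cmult_right DERIV_ident)
    then show "((\<lambda>s. f (x + s *\<^sub>R axis i 1) - s * c) has_real_derivative
        partial i f (x + s *\<^sub>R axis i 1) - c) (at s within closed_segment 0 t)"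
      by (simp add: has_field_derivative_at_within)
    show "norm (partial i f (x + s *\<^sub>R axis i 1) - c) \<le> B" using B[OF s] by simp
  qed auto
  then show ?thesis by (simp add: algebra_simps)
qed

text \<open>Continuity of the partial derivatives is what makes the coordinatewise notion of
  smoothness imply total differentiability.\<close>
lemma smooth_on_has_derivative:
  fixes f :: "real^'n::finite \<Rightarrow> real"
  assumes f: "smooth_on S f" and x: "x \<in> S"
  shows "(f has_derivative (\<lambda>h. \<Sum>i\<in>UNIV. h $ i * partial i f x)) (at x)"
proof -
  \<comment> \<open>\<open>hA A h\<close> keeps the coordinates of the increment that lie in
    \<open>A\<close>; induction on \<open>A\<close> walks from x to x + h one coordinate at a
    time.\<close>
  define hA where "hA A h = (\<chi> i. if i \<in> A then h $ i else 0)" for A and h :: "real^'n"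
  have hA_norm: "norm (hA A h) \<le> norm h" for A h
    unfolding hA_def by (rule norm_le_componentwise_cart) simp
  have key: "\<forall>e>0. \<exists>d>0. \<forall>h. norm h < d \<longrightarrow>
      \<bar>f (x + hA A h) - f x - (\<Sum>i\<in>A. h $ i * partial i f x)\<bar> \<le> e * norm h" for A :: "'n set"
    using finite[of A]
  proof (induction A rule: finite_induct)
    case empty
    then show ?case by (auto simp: hA_def zero_vec_def[symmetric] intro!: exI[of _ 1])
  next
    case (insert j A)
    show ?case
    proof (intro allI impI)
      fix e :: real assume "e > 0"
      then obtain d1 where d1: "d1 > 0" "\<And>h. norm h < d1 \<Longrightarrow>
          \<bar>f (x + hA A h) - f x - (\<Sum>i\<in>A. h $ i * partial i f x)\<bar> \<le> e / 2 * norm h"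
        using insert.IH[rule_format, of "e/2"] by auto
      have "isCont (partial j f) x"
        using smooth_on_continuous[OF smooth_on_partial[OF f]] smooth_on_open[OF f] x
        by (simp add: continuous_on_eq_continuous_at)
      then obtain d2 where d2: "d2 > 0" "\<And>y. dist y x < d2 \<Longrightarrow> dist (partial j f y) (partial j f x) < e / 2"
        using \<open>e > 0\<close> unfolding continuous_at_eps_delta by (metis half_gt_zero)
      obtain d3 where d3: "d3 > 0" "ball x d3 \<subseteq> S"
        using smooth_on_open[OF f] x open_contains_ball by blast
      show "\<exists>d>0. \<forall>h. norm h < d \<longrightarrow>
        \<bar>f (x + hA (insert j A) h) - f x - (\<Sum>i\<in>insert j A. h $ i * partial i f x)\<bar> \<le> e * norm h"
      proof (intro exI[of _ "min d1 (min d2 d3)"] conjI allI impI)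
        fix h :: "real^'n" assume h: "norm h < min d1 (min d2 d3)"
        \<comment> \<open>Every intermediate point is coordinatewise no larger than h, so the path
          stays in the ball where the partial derivative is close to its value at x.\<close>
        have small: "norm (hA A h + s *\<^sub>R axis j 1) \<le> norm h" if "s \<in> closed_segment 0 (h $ j)" for s
        proof (rule norm_le_componentwise_cart)
          fix i
          have "\<bar>s\<bar> \<le> \<bar>h $ j\<bar>"
            using that by (auto simp: closed_segment_eq_real_ivl split: if_splits)
          then show "norm ((hA A h + s *\<^sub>R axis j 1) $ i) \<le> norm (h $ i)"
            using insert.hyps(2) by (auto simp: hA_def axis_def)
        qed
        have e1: "hA (insert j A) h = hA A h + (h $ j) *\<^sub>R axis j 1"
          using insert.hyps(2) by (auto simp: hA_def axis_def vec_eq_iff)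
        have "\<bar>f ((x + hA A h) + (h $ j) *\<^sub>R axis j 1) - f (x + hA A h) - h $ j * partial j f x\<bar> \<le> e / 2 * \<bar>h $ j\<bar>"
        proof (rule smooth_on_line_bound[OF f])
          fix s assume s: "s \<in> closed_segment 0 (h $ j)"
          have dd: "dist (x + hA A h + s *\<^sub>R axis j 1) x \<le> norm h"
            using small[OF s] by (simp add: dist_norm add.assoc)
          then show "x + hA A h + s *\<^sub>R axis j 1 \<in> S"
            using h d3(2) by (auto simp: dist_commute subset_iff)
          show "\<bar>partial j f (x + hA A h + s *\<^sub>R axis j 1) - partial j f x\<bar> \<le> e / 2"
            using d2(2)[of "x + hA A h + s *\<^sub>R axis j 1"] dd h by (auto simp: dist_real_def)
        qed
        also have "\<dots> \<le> e / 2 * norm h"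
          using \<open>e > 0\<close> component_le_norm_cart[of h j] by (intro mult_left_mono) auto
        finally have a: "\<bar>f (x + hA (insert j A) h) - f (x + hA A h) - h $ j * partial j f x\<bar> \<le> e / 2 * norm h"
          by (simp add: e1 add.assoc)
        have "\<bar>f (x + hA A h) - f x - (\<Sum>i\<in>A. h $ i * partial i f x)\<bar> \<le> e / 2 * norm h"
          using d1(2) h by simp
        with a have "\<bar>f (x + hA (insert j A) h) - f x -
            (h $ j * partial j f x + (\<Sum>i\<in>A. h $ i * partial i f x))\<bar> \<le> e / 2 * norm h + e / 2 * norm h"
          by linarith
        then show "\<bar>f (x + hA (insert j A) h) - f x - (\<Sum>i\<in>insert j A. h $ i * partial i f x)\<bar> \<le> e * norm h"
          using insert.hyps by simp
      qed (use d1 d2 d3 in auto)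
    qed
  qed
  have hU: "hA UNIV h = h" for h by (simp add: hA_def vec_eq_iff)
  show ?thesis unfolding has_derivative_at_alt
  proof (intro conjI allI impI)
    show "bounded_linear (\<lambda>h. \<Sum>i\<in>UNIV. h $ i * partial i f x)"
      by (intro bounded_linear_sum bounded_linear_mult_const bounded_linear_vec_nth)
    fix e :: real assume "e > 0"
    then obtain d where d: "d > 0" "\<And>h. norm h < d \<Longrightarrow>
        \<bar>f (x + hA UNIV h) - f x - (\<Sum>i\<in>UNIV. h $ i * partial i f x)\<bar> \<le> e * norm h"
      using key[of UNIV] by blast
    show "\<exists>d>0. \<forall>y. norm (y - x) < d \<longrightarrow>
        norm (f y - f x - (\<Sum>i\<in>UNIV. (y - x) $ i * partial i f x)) \<le> e * norm (y - x)"
      using d(1) d(2)[of "y - x" for y] unfolding hU by (intro exI[of _ d]) auto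
  qed
qed

subsection \<open>Homogeneous functions of degree zero\<close>

definition homog0 :: "(real^'n::finite \<Rightarrow> real) \<Rightarrow> bool" where
  "homog0 f \<longleftrightarrow> (\<forall>c>0. \<forall>x. x \<noteq> 0 \<longrightarrow> f (c *\<^sub>R x) = f x)"

text \<open>Differentiate t -> f(x + t x), constant near 0. The direction x is not an axis, so the
  chain rule needs the total derivative.\<close>

lemma homog0_euler:
  assumes f: "smooth_on (-{0}) f" "homog0 f" and x: "x \<noteq> 0"
  shows "(\<Sum>i\<in>UNIV. x $ i * partial i f x) = 0"
proof -
  have 1: "((\<lambda>t. x + t *\<^sub>R x) has_derivative (\<lambda>t. t *\<^sub>R x)) (at (0::real))"
    by (auto intro!: derivative_eq_intros)
  have "((\<lambda>t. f (x + t *\<^sub>R x)) has_derivative (\<lambda>t. \<Sum>i\<in>UNIV. (t *\<^sub>R x) $ i * partial i f x)) (at (0::real))"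
    by (rule has_derivative_compose[OF 1]) (use smooth_on_has_derivative[OF f(1)] x in simp)
  then have "((\<lambda>t. f (x + t *\<^sub>R x)) has_real_derivative (\<Sum>i\<in>UNIV. x $ i * partial i f x)) (at 0)"
    unfolding has_field_derivative_def
    by (rule has_derivative_eq_rhs) (simp add: fun_eq_iff sum_distrib_left sum_distrib_right mult_ac)
  moreover have "((\<lambda>t. f (x + t *\<^sub>R x)) has_real_derivative 0) (at 0)"
  proof (rule has_field_derivative_transform_within_open[of "\<lambda>_. f x" _ _ "{-1<..}"])
    fix t :: real assume "t \<in> {-1<..}"
    then have "f ((1 + t) *\<^sub>R x) = f x" using f(2) x unfolding homog0_def by simp
    then show "f x = f (x + t *\<^sub>R x)" by (simp add: algebra_simps)
  qed auto
  ultimately show ?thesis by (rule DERIV_unique)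
qed

text \<open>The factor \<open>K\<close> allows iteration: the rule applies with \<open>K = 1\<close>
  to f and then with \<open>K = 1 / c\<close> to its partial derivatives.\<close>

lemma partial_scale:
  fixes f :: "real^'n::finite \<Rightarrow> real"
  assumes f: "smooth_on (-{0}) f" and c: "c > 0"
    and h: "\<And>y. y \<noteq> 0 \<Longrightarrow> f (c *\<^sub>R y) = K * f y" and x: "x \<noteq> 0"
  shows "partial i f (c *\<^sub>R x) = K / c * partial i f x"
proof -
  have "((\<lambda>t. t / c) has_real_derivative 1 / c) (at 0)"
    using c by (auto intro!: derivative_eq_intros)
  moreover have "has_partial f i (partial i f x) x"
    using smooth_on_has_partial[OF f] x by simp
  ultimately have "((\<lambda>t. f (x + (t / c) *\<^sub>R axis i 1)) has_real_derivative partial i f x * (1 / c)) (at 0)"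
    using DERIV_chain2[of "\<lambda>t. f (x + t *\<^sub>R axis i 1)" "partial i f x" "\<lambda>t. t / c" 0 "1 / c" UNIV] by simp
  then have "((\<lambda>t. K * f (x + (t / c) *\<^sub>R axis i 1)) has_real_derivative K * (partial i f x * (1 / c))) (at 0)"
    by (rule DERIV_cmult)
  then have d: "has_partial (\<lambda>y. K * f (inverse c *\<^sub>R y)) i (K / c * partial i f x) (c *\<^sub>R x)"
    using c by (simp add: scaleR_add_right divide_inverse mult_ac)
  have "has_partial f i (K / c * partial i f x) (c *\<^sub>R x)"
  proof (rule has_partial_cong[of "-{0}", OF _ _ _ d])
    show "K * f (inverse c *\<^sub>R y) = f y" if "y \<in> -{0}" for y
      using h[of "inverse c *\<^sub>R y"] that c by simp
  qed (use c x in auto)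
  then show ?thesis by (rule has_partial_imp)
qed

definition Tl :: "(real^'n::finite \<Rightarrow> real) \<Rightarrow> real^'n \<Rightarrow> real" where
  "Tl f x = (x \<bullet> x) * laplacian f x"

lemma homog0_Tl:
  assumes "smooth_on (-{0}) f" "homog0 f"
  shows "smooth_on (-{0}) (Tl f)" "homog0 (Tl f)"
proof -
  show "smooth_on (-{0}) (Tl f)"
    unfolding Tl_def[abs_def] by (intro smooth_on_mult smooth_on_inner smooth_on_laplacian assms open_Compl closed_singleton)
  have "laplacian f (c *\<^sub>R x) = 1 / c / c * laplacian f x" if "c > 0" "x \<noteq> 0" for c x
  proof -
    have 1: "partial i f (c *\<^sub>R y) = 1 / c * partial i f y" if "y \<noteq> 0" for i y
      by (rule partial_scale[OF assms(1) \<open>c > 0\<close> _ that]) (use assms(2) \<open>c > 0\<close> in \<open>auto simp: homog0_def\<close>)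
    have "partial i (partial i f) (c *\<^sub>R x) = 1 / c / c * partial i (partial i f) x" for i
      by (rule partial_scale[OF smooth_on_partial[OF assms(1)] \<open>c > 0\<close> 1 \<open>x \<noteq> 0\<close>])
    then show ?thesis by (simp add: laplacian_def sum_distrib_left)
  qed
  then show "homog0 (Tl f)" by (auto simp: homog0_def Tl_def)
qed

lemma homog0_diff_const_mult:
  assumes "smooth_on (-{0}) f" "homog0 f" "smooth_on (-{0}) g" "homog0 g"
  shows "smooth_on (-{0}) (\<lambda>x. f x - c * g x)" "homog0 (\<lambda>x. f x - c * g x)"
  using assms by (auto intro!: smooth_on_diff smooth_on_mult smooth_on_const simp: homog0_def)

lemma homog0_bounded:
  assumes "continuous_on (-{0}) f" "homog0 f"
  obtains B where "B \<ge> 0" "\<And>x. x \<noteq> 0 \<Longrightarrow> \<bar>f x\<bar> \<le> B"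
proof -
  have "compact (f ` sphere 0 1)"
    by (intro compact_continuous_image continuous_on_subset[OF assms(1)] compact_sphere) auto
  then obtain B where B: "\<And>y. y \<in> sphere 0 1 \<Longrightarrow> norm (f y) \<le> B"
    using compact_imp_bounded[of "f ` sphere 0 1"] unfolding bounded_iff by blast
  show thesis
  proof (rule that[of "max B 0"])
    fix x :: "real^'a" assume "x \<noteq> 0"
    then have "f (inverse (norm x) *\<^sub>R x) = f x" using assms(2) unfolding homog0_def by simp
    moreover have "inverse (norm x) *\<^sub>R x \<in> sphere 0 1" using \<open>x \<noteq> 0\<close> by simp
    ultimately show "\<bar>f x\<bar> \<le> max B 0" using B by fastforce
  qed simp
qed

subsection \<open>Integration by parts with radial weights\<close>

lemma integrable_continuous_compact_support:
  fixes f :: "real^'n::finite \<Rightarrow> real"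
  assumes "continuous_on UNIV f" "\<And>x. norm x > R \<Longrightarrow> f x = 0"
  shows "integrable lborel f"
proof -
  have "integrable lborel (\<lambda>x. indicator (cball 0 R) x *\<^sub>R f x)"
    by (rule borel_integrable_compact[OF compact_cball continuous_on_subset[OF assms(1)]]) simp
  also have "(\<lambda>x. indicator (cball 0 R) x *\<^sub>R f x) = f"
    using assms(2) by (auto simp: indicator_def fun_eq_iff not_le)
  finally show ?thesis .
qed

lemma integral_translate:
  fixes f :: "real^'n::finite \<Rightarrow> real"
  assumes "f \<in> borel_measurable borel"
  shows "(LINT x|lborel. f (x + c)) = (LINT x|lborel. f x)"
proof -
  have "(LINT x|lborel. f x) = (LINT x|distr lborel borel ((+) c). f x)"
    by (simp add: lborel_distr_plus)
  also have "\<dots> = (LINT x|lborel. f (c + x))"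
    by (rule integral_distr) (use assms in auto)
  finally show ?thesis by (simp add: add.commute)
qed

lemma partial_outside:
  fixes F :: "real^'n::finite \<Rightarrow> real"
  assumes "\<And>x. norm x > R \<Longrightarrow> F x = 0" "norm x > R"
  shows "partial i F x = 0"
proof -
  have "open {y::real^'n. norm y > R}" by (intro open_Collect_less continuous_intros)
  then have "has_partial F i 0 x"
    by (rule has_partial_cong[where f="\<lambda>_. 0"]) (use assms in auto)
  then show ?thesis by (rule has_partial_imp)
qed

lemma partial_inside:
  fixes F :: "real^'n::finite \<Rightarrow> real"
  assumes "\<And>x. norm x < R \<Longrightarrow> F x = 0" "norm x < R"
  shows "partial i F x = 0"
proof -
  have "open {y::real^'n. norm y < R}" by (intro open_Collect_less continuous_intros)
  then have "has_partial F i 0 x"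
    by (rule has_partial_cong[where f="\<lambda>_. 0"]) (use assms in auto)
  then show ?thesis by (rule has_partial_imp)
qed

text \<open>The integral of a difference quotient vanishes by translation invariance of Lebesgue
  measure, and dominated convergence carries this over to the derivative.\<close>

lemma integral_partial_eq_0:
  fixes F :: "real^'n::finite \<Rightarrow> real"
  assumes F: "smooth_on UNIV F" and supp: "\<And>x. norm x > R \<Longrightarrow> F x = 0"
  shows "integrable lborel (partial i F)" "(LINT x|lborel. partial i F x) = 0"
proof -
  let ?e = "axis i 1 :: real^'n"
  have cF: "continuous_on UNIV F" using smooth_on_continuous[OF F] .
  have cP: "continuous_on UNIV (partial i F)" using smooth_on_continuous[OF smooth_on_partial[OF F]] .
  have P0: "partial i F x = 0" if "norm x > R" for x using partial_outside[of R F x] supp that by blast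
  show "integrable lborel (partial i F)"
    by (rule integrable_continuous_compact_support[OF cP P0])
  have mF: "F \<in> borel_measurable borel" using cF by (rule borel_measurable_continuous_onI)
  have iF: "integrable lborel F" by (rule integrable_continuous_compact_support[OF cF supp])
  have iT: "integrable lborel (\<lambda>x. F (x + t *\<^sub>R ?e))" for t
  proof (rule integrable_continuous_compact_support[of _ "R + \<bar>t\<bar>"])
    show "continuous_on UNIV (\<lambda>x. F (x + t *\<^sub>R ?e))"
      by (rule continuous_on_compose2[OF cF]) (auto intro!: continuous_intros)
    show "F (x + t *\<^sub>R ?e) = 0" if "norm x > R + \<bar>t\<bar>" for x
      by (rule supp) (use norm_diff_ineq[of x "t *\<^sub>R ?e"] that in auto)
  qed
  have "bounded (partial i F ` cball 0 R)"
    by (intro compact_imp_bounded compact_continuous_image continuous_on_subset[OF cP]) auto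
  then obtain B0 where B0: "\<And>x. x \<in> cball 0 R \<Longrightarrow> norm (partial i F x) \<le> B0"
    unfolding bounded_iff by (metis imageI)
  \<comment> \<open>The maximum covers \<open>R < 0\<close>, where the ball is empty and
    \<open>B0\<close> may be negative.\<close>
  define B where "B = max B0 0"
  have B: "\<bar>partial i F x\<bar> \<le> B" "B \<ge> 0" for x
    using B0[of x] P0[of x] by (cases "norm x > R"; force simp: B_def)+
  \<comment> \<open>Steps in (0,1], so that every difference quotient lives in the ball of radius R
    + 1, the support of the dominating function.\<close>
  define t :: "nat \<Rightarrow> real" where "t k = inverse (real (Suc k))" for k
  have t: "0 < t k" "t k \<le> 1" for k
    unfolding t_def by (auto simp: field_simps)
  define s where "s k x = (F (x + t k *\<^sub>R ?e) - F x) / t k" for k x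
  have "(LINT x|lborel. s k x) = 0" for k
    unfolding s_def using iT iF integral_translate[OF mF] by simp
  moreover have "(\<lambda>k. LINT x|lborel. s k x) \<longlonglongrightarrow> (LINT x|lborel. partial i F x)"
  proof (rule integral_dominated_convergence[where w="\<lambda>x. B * indicator (cball 0 (R + 1)) x"])
    show "partial i F \<in> borel_measurable lborel" using cP by (simp add: borel_measurable_continuous_onI)
    show "s k \<in> borel_measurable lborel" for k
      unfolding s_def using borel_measurable_integrable[OF iT] borel_measurable_integrable[OF iF] by simp
    show "integrable lborel (\<lambda>x. B * indicator (cball 0 (R + 1)) x :: real)"
      by (intro integrable_mult_right integrable_real_indicator) (simp_all add: emeasure_bounded_finite[OF bounded_cball, unfolded infinity_ennreal_def])
    have "(\<lambda>k. s k x) \<longlonglongrightarrow> partial i F x" for x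
    proof -
      have "((\<lambda>h. (F (x + h *\<^sub>R ?e) - F x) / h) \<longlongrightarrow> partial i F x) (at 0)"
        using smooth_on_has_partial[OF F, of x i] by (simp add: has_field_derivative_iff)
      moreover have "filterlim t (at 0) sequentially"
        unfolding filterlim_at using t(1) LIMSEQ_inverse_real_of_nat
        by (auto simp: t_def[abs_def] intro!: always_eventually)
      ultimately show ?thesis unfolding s_def by (rule filterlim_compose)
    qed
    then show "AE x in lborel. (\<lambda>k. s k x) \<longlonglongrightarrow> partial i F x" by simp
    have "\<bar>s k x\<bar> \<le> B * indicator (cball 0 (R + 1)) x" for k x
    proof (cases "norm x \<le> R + 1")
      case True
      have "\<bar>F (x + t k *\<^sub>R ?e) - F x - t k * 0\<bar> \<le> B * \<bar>t k\<bar>"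
        by (rule smooth_on_line_bound[OF F]) (use B in auto)
      then show ?thesis using True t(1)[of k] by (simp add: s_def field_simps)
    next
      case False
      have "norm (x + t k *\<^sub>R ?e) > R"
        using norm_diff_ineq[of x "t k *\<^sub>R ?e"] False t[of k] by simp
      then show ?thesis using supp[of x] supp False by (simp add: s_def)
    qed
    then show "AE x in lborel. norm (s k x) \<le> B * indicator (cball 0 (R + 1)) x" for k by simp
  qed
  ultimately show "(LINT x|lborel. partial i F x) = 0"
    using LIMSEQ_unique[OF _ tendsto_const] by simp
qed

lemma smooth_on_extend_0:
  fixes F :: "real^'n::finite \<Rightarrow> real"
  assumes "smooth_on (-{0}) F" "r > 0" "\<And>x. norm x < r \<Longrightarrow> F x = 0"
  shows "smooth_on UNIV F"
proof -
  have "smooth_on (ball 0 r) F"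
    by (rule smooth_on_cong[OF smooth_on_const[of "ball 0 r" 0]]) (use assms in auto)
  then have "smooth_on (-{0} \<union> ball 0 r) F" by (intro smooth_on_Un assms)
  moreover have "-{0} \<union> ball 0 r = (UNIV :: (real^'n) set)" using assms(2) by auto
  ultimately show ?thesis by simp
qed

lemma smooth_on_radial:
  assumes "\<And>k. diff_n k {0<..} h"
  shows "smooth_on (-{0}) (\<lambda>x. h (x \<bullet> x))"
  by (rule smooth_on_compose[OF assms smooth_on_inner]) auto

lemma has_partial_radial:
  assumes "\<And>t. t > 0 \<Longrightarrow> (h has_real_derivative h' t) (at t)" "x \<noteq> 0"
  shows "has_partial (\<lambda>x. h (x \<bullet> x)) i (h' (x \<bullet> x) * (2 * x $ i)) x"
  using DERIV_chain2[of h "h' (x \<bullet> x)" "\<lambda>t. (x + t *\<^sub>R axis i 1) \<bullet> (x + t *\<^sub>R axis i 1)" 0 "2 * x $ i" UNIV]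
    assms has_partial_inner[of x i] by simp

text \<open>The divergence theorem for the field k f grad g. The derivative of the weight enters
  only through x . grad g, which is 0 because g is 0-homogeneous.\<close>

lemma green_radial_weight:
  fixes f g :: "real^'n::finite \<Rightarrow> real"
  assumes f: "smooth_on (-{0}) f" and g: "smooth_on (-{0}) g" "homog0 g"
    and k: "\<And>n. diff_n n {0<..} k" "\<And>t. t \<le> 1 \<Longrightarrow> k t = 0" "\<And>t. t \<ge> R \<Longrightarrow> k t = 0" "R \<ge> 1"
  shows "(LINT x|lborel. k (x \<bullet> x) * (f x * laplacian g x + (\<Sum>i\<in>UNIV. partial i f x * partial i g x))) = 0"
proof -
  obtain k' where k': "\<And>t. t > 0 \<Longrightarrow> (k has_real_derivative k' t) (at t)"
    using k(1)[of 1] by auto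
  define F where "F i x = k (x \<bullet> x) * f x * partial i g x" for i x
  have out: "F i x = 0" if "norm x > sqrt R" for i x
  proof -
    have "x \<bullet> x \<ge> R" using that k(4) by (simp add: dot_square_norm real_le_rsqrt sqrt_le_D less_imp_le)
    then show ?thesis by (simp add: F_def k(3))
  qed
  have ins: "k (x \<bullet> x) = 0" if "norm x < 1" for x :: "real^'n"
    using that by (intro k(2)) (simp add: dot_square_norm power_le_one)
  then have ins': "F i x = 0" if "norm x < 1" for i x using that by (simp add: F_def)
  have "smooth_on (-{0}) (F i)" for i
    unfolding F_def[abs_def] by (intro smooth_on_mult smooth_on_radial k f smooth_on_partial g)
  then have sF: "smooth_on UNIV (F i)" for i
    by (rule smooth_on_extend_0[of _ 1]) (use ins' in auto)
  have "(\<Sum>i\<in>UNIV. partial i (F i) x) =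
      k (x \<bullet> x) * (f x * laplacian g x + (\<Sum>i\<in>UNIV. partial i f x * partial i g x))" for x
  proof (cases "x = 0")
    case True
    then show ?thesis using partial_inside[of 1 "F i" x i for i] ins' ins[of x] by simp
  next
    case False
    then have x: "x \<in> -{0}" by simp
    have "partial i (F i) x = (k' (x \<bullet> x) * (2 * x $ i) * f x + partial i f x * k (x \<bullet> x)) * partial i g x
        + partial i (partial i g) x * (k (x \<bullet> x) * f x)" for i
      unfolding F_def
      using DERIV_mult[OF DERIV_mult[OF has_partial_radial[OF k' False, of i] smooth_on_has_partial[OF f x, of i]]
          smooth_on_has_partial[OF smooth_on_partial[OF g(1), of i] x, of i]]
      by (intro has_partial_imp) simp
    then have "(\<Sum>i\<in>UNIV. partial i (F i) x) =
        2 * k' (x \<bullet> x) * f x * (\<Sum>i\<in>UNIV. x $ i * partial i g x) +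
        k (x \<bullet> x) * (f x * laplacian g x + (\<Sum>i\<in>UNIV. partial i f x * partial i g x))"
      by (simp add: laplacian_def sum.distrib sum_distrib_left algebra_simps)
    then show ?thesis using homog0_euler[OF g False] by simp
  qed
  then have "(LINT x|lborel. k (x \<bullet> x) * (f x * laplacian g x + (\<Sum>i\<in>UNIV. partial i f x * partial i g x)))
    = (LINT x|lborel. (\<Sum>i\<in>UNIV. partial i (F i) x))" by simp
  also have "\<dots> = 0"
    using integral_partial_eq_0[OF sF out] by simp
  finally show ?thesis .
qed

text \<open>The cross term is a multiple of x . grad g and drops out by Euler's identity. The rest
  is the Laplacian of the radial factor, which for a function h of t = |x|^2 reads 4 t h'' + 2 n
  h'.\<close>

lemma laplacian_radial_mult:
  fixes g :: "real^'n::finite \<Rightarrow> real"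
  assumes g: "smooth_on (-{0}) g" "homog0 g"
    and h: "\<And>t. t > 0 \<Longrightarrow> (h has_real_derivative h' t) (at t)"
      "\<And>t. t > 0 \<Longrightarrow> (h' has_real_derivative h'' t) (at t)"
    and x: "x \<noteq> 0"
  shows "laplacian (\<lambda>x. h (x \<bullet> x) * g x) x = h (x \<bullet> x) * laplacian g x +
    (4 * (x \<bullet> x) * h'' (x \<bullet> x) + 2 * real CARD('n) * h' (x \<bullet> x)) * g x"
proof -
  have p1: "partial i (\<lambda>x. h (x \<bullet> x) * g x) y = h' (y \<bullet> y) * (2 * y $ i) * g y + partial i g y * h (y \<bullet> y)"
    if "y \<noteq> 0" for i y
    using DERIV_mult[OF has_partial_radial[OF h(1) that, of i] smooth_on_has_partial[OF g(1), of y i]] that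
    by (intro has_partial_imp) simp
  have p2: "partial i (\<lambda>y. h' (y \<bullet> y) * (2 * y $ i) * g y + partial i g y * h (y \<bullet> y)) x =
      (h'' (x \<bullet> x) * (2 * x $ i) * (2 * x $ i) + 2 * h' (x \<bullet> x)) * g x
      + partial i g x * (h' (x \<bullet> x) * (2 * x $ i))
      + (partial i (partial i g) x * h (x \<bullet> x) + h' (x \<bullet> x) * (2 * x $ i) * partial i g x)" for i
  proof -
    have c: "has_partial (\<lambda>y. 2 * y $ i) i 2 x"
      using DERIV_cmult[OF has_partial_component[where i=i and j=i and x=x], of 2] by simp
    show ?thesis
      using DERIV_add[OF DERIV_mult[OF DERIV_mult[OF has_partial_radial[OF h(2) x, of i] c]
          smooth_on_has_partial[OF g(1), of x i]]
        DERIV_mult[OF smooth_on_has_partial[OF smooth_on_partial[OF g(1), of i], of x i] has_partial_radial[OF h(1) x, of i]]] x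
      by (intro has_partial_imp) (simp add: algebra_simps)
  qed
  have "partial i (partial i (\<lambda>x. h (x \<bullet> x) * g x)) x =
      4 * h'' (x \<bullet> x) * g x * (x $ i * x $ i) + 2 * h' (x \<bullet> x) * g x
      + 4 * h' (x \<bullet> x) * (x $ i * partial i g x) + h (x \<bullet> x) * partial i (partial i g) x" for i
    using partial_cong[of "-{0}" x "partial i (\<lambda>x. h (x \<bullet> x) * g x)", OF open_Compl[OF closed_singleton] _ p1] x p2[of i]
    by (simp add: algebra_simps)
  then have "laplacian (\<lambda>x. h (x \<bullet> x) * g x) x =
     4 * h'' (x \<bullet> x) * g x * (\<Sum>i\<in>UNIV. x $ i * x $ i) + real CARD('n) * (2 * h' (x \<bullet> x) * g x)
      + 4 * h' (x \<bullet> x) * (\<Sum>i\<in>UNIV. x $ i * partial i g x) + h (x \<bullet> x) * (\<Sum>i\<in>UNIV. partial i (partial i g) x)"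
    unfolding laplacian_def by (simp add: sum.distrib sum_distrib_left)
  also have "(\<Sum>i\<in>UNIV. x $ i * x $ i) = x \<bullet> x" by (simp add: inner_vec_def)
  finally show ?thesis using homog0_euler[OF g x] by (simp add: laplacian_def algebra_simps)
qed

subsection \<open>The Joseph--Lundgren range\<close>

text \<open>Put y = \<alpha> + 3 - n/2, the offset from the centre of the symmetry \<alpha> -> n - 6
  - \<alpha>. The product on the left is ((n+2)^2/4 - y^2) ((n-2)^2/4 - y^2), so left minus right is
  quadratic in y^2, with roots (n^2 + 4 - n Q)/4 and (n^2 + 4 + n Q)/4 for Q = sqrt(n^2 - 8n + 32).
  It remains to see that y^2 lies below the smaller root s^2/4; the critical exponent is the value
  of (\<alpha> + 4)/\<alpha> at y = -s/2.\<close>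

lemma pc_bar_coefficient:
  fixes \<alpha> :: real and n :: nat
  assumes n: "n \<ge> 5" and al: "0 < \<alpha>" "2 * \<alpha> < real n - 4"
    and p: "ereal ((\<alpha> + 4) / \<alpha>) < pc_bar n"
  shows "(\<alpha> + 4) * (\<alpha> + 2) * (real n - 2 - \<alpha>) * (real n - 4 - \<alpha>) > (real n * (real n - 4) / 4)^2"
proof -
  define N where "N = real n"
  have N: "N \<ge> 5" using n by (simp add: N_def)
  define Q where "Q = sqrt (N^2 - 8 * N + 32)"
  have rad: "N^2 - 8 * N + 32 = (N - 4)^2 + 16" by (simp add: power2_eq_square algebra_simps)
  have Q2: "Q^2 = N^2 - 8 * N + 32" unfolding Q_def by (rule real_sqrt_pow2) (simp add: rad)
  have Q0: "Q > 0" unfolding Q_def by (simp add: rad add_nonneg_pos)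
  have "Q < N" unfolding Q_def by (rule real_less_lsqrt) (use N in auto)
  define D where "D = N^2 + 4 - N * Q"
  have D4: "D > 4" using \<open>Q < N\<close> N by (simp add: D_def power2_eq_square)
  define s where "s = sqrt D"
  have s2: "s^2 = D" "s > 2"
    unfolding s_def using D4 by (auto intro!: real_less_rsqrt)
  have NQ: "(N * Q)^2 = N^2 * (N^2 - 8 * N + 32)" by (simp add: power_mult_distrib Q2)
  \<comment> \<open>This is y > -s/2. For n <= 12 already n - 6 < s; for larger n it is the bound by
    \<open>pc_bar n\<close>, rewritten.\<close>
  have low: "2 * \<alpha> > N - 6 - s"
  proof (cases "n \<le> 12")
    case True
    \<comment> \<open>Squaring reduces n - 6 < s to N Q < 12 N - 32, and squaring again gives an
      inequality between integers for each of the eight dimensions.\<close>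
    then have "n \<in> {5,6,7,8,9,10,11,12}" using n by auto
    then have "N^2 * (N^2 - 8 * N + 32) < (12 * N - 32)^2"
      unfolding N_def by auto
    then have "N * Q < 12 * N - 32"
      unfolding NQ[symmetric] by (rule power2_less_imp_less) (use N in auto)
    then have "(N - 6)^2 < s^2" unfolding s2 D_def by (simp add: power2_eq_square algebra_simps)
    then have "N - 6 < s" by (rule power2_less_imp_less) (use s2 in auto)
    then show ?thesis using al by simp
  next
    case False
    then have "N \<ge> 13" by (simp add: N_def)
    \<comment> \<open>The shift by 13 makes every coefficient of the difference positive; the
      constant 1017 is its value at n = 13.\<close>
    then obtain k where k: "N = 13 + k" "k \<ge> 0" by (metis add_diff_cancel_left' le_add_diff_inverse diff_ge_0_iff_ge)
    have "N^2 * (N^2 - 8 * N + 32) - (12 * N - 32)^2 = k^4 + 44 * k^3 + 590 * k^2 + 2588 * k + 1017"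
      unfolding k by (simp add: power2_eq_square power3_eq_cube power4_eq_xxxx algebra_simps)
    also have "\<dots> > 0" using k(2) by (intro add_nonneg_pos add_nonneg_nonneg) auto
    finally have "(12 * N - 32)^2 < (N * Q)^2" by (simp add: NQ)
    then have "12 * N - 32 < N * Q" by (rule power2_less_imp_less) (use N Q0 in auto)
    then have "s^2 < (N - 6)^2" unfolding s2 D_def by (simp add: power2_eq_square algebra_simps)
    then have pos: "N - 6 - s > 0" using power2_less_imp_less[of s "N - 6"] \<open>N \<ge> 13\<close> by simp
    have "(\<alpha> + 4) / \<alpha> < (N + 2 - s) / (N - 6 - s)"
      using p False by (simp add: pc_bar_def Let_def s_def D_def Q_def N_def)
    then have "(\<alpha> + 4) * (N - 6 - s) < (N + 2 - s) * \<alpha>"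
      using pos al(1) by (simp add: divide_simps)
    then show ?thesis by (simp add: algebra_simps)
  qed
  define y where "y = \<alpha> + 3 - N / 2"
  \<comment> \<open>The upper side comes from y < 1 < s/2, by 2 \<alpha> < n - 4 and s > 2.\<close>
  have "\<bar>y\<bar> < s / 2" using low al(2) s2(2) by (auto simp: y_def N_def abs_if)
  then have "y^2 < (s / 2)^2" by (metis abs_ge_zero power2_abs power_strict_mono zero_less_numeral)
  then have Y: "y^2 < D / 4" by (simp add: power_divide s2)
  have "D / 4 < (N^2 + 4 + N * Q) / 4" using N Q0 by (simp add: D_def)
  with Y have "(D / 4 - y^2) * ((N^2 + 4 + N * Q) / 4 - y^2) > 0" by simp
  also have "(D / 4 - y^2) * ((N^2 + 4 + N * Q) / 4 - y^2)
     = (((N^2 + 4)^2 - (N * Q)^2) / 16 - (N^2 + 4) / 2 * y^2 + y^4)"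
    unfolding D_def by (simp add: power2_eq_square power4_eq_xxxx field_simps)
  also have "\<dots> = (\<alpha> + 4) * (\<alpha> + 2) * (N - 2 - \<alpha>) * (N - 4 - \<alpha>) - (N * (N - 4) / 4)^2"
    unfolding NQ y_def by (simp add: power2_eq_square power4_eq_xxxx field_simps)
  finally show ?thesis by (simp add: N_def)
qed

text \<open>The bound p > (n+4)/(n-4) says 2 \<alpha> < n - 4, which makes a and b positive. The
  third conclusion follows from the second: (2A)^2 <= 4 p a b <= 4 p^2 a b <= p^2 (a + b)^2.\<close>

lemma subcritical_coefficients:
  fixes p :: real and n :: nat
  assumes n: "n \<ge> 5" and p: "(real n + 4) / (real n - 4) < p" "ereal p < pc_bar n"
  defines "\<alpha> \<equiv> 4 / (p - 1)" and "A \<equiv> real n * (real n - 4) / 4"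
  defines "a \<equiv> \<alpha> * (real n - 2 - \<alpha>)" and "b \<equiv> (\<alpha> + 2) * (real n - 4 - \<alpha>)"
  shows "p > 1" "p * a * b > A^2" "p * (a + b) \<ge> 2 * A"
proof -
  have "(real n + 4) / (real n - 4) > 1" using n by (simp add: field_simps)
  then show p1: "p > 1" using p by simp
  have al: "\<alpha> > 0" using p1 by (simp add: \<alpha>_def)
  have "real n + 4 < p * (real n - 4)" using p(1) n by (simp add: field_simps)
  then have al2: "2 * \<alpha> < real n - 4" using p1 by (simp add: \<alpha>_def field_simps)
  have pe: "p = (\<alpha> + 4) / \<alpha>" using p1 by (simp add: \<alpha>_def field_simps)
  have "p * a * b = (\<alpha> + 4) * (\<alpha> + 2) * (real n - 2 - \<alpha>) * (real n - 4 - \<alpha>)"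
    using al unfolding pe a_def b_def by (simp add: field_simps)
  then show pab: "p * a * b > A^2"
    using pc_bar_coefficient[OF n al al2] p(2) pe unfolding A_def by simp
  have ab: "a > 0" "b > 0" using al al2 by (auto simp: a_def b_def)
  have "(2 * A)^2 = 4 * A^2" by (simp add: power2_eq_square)
  also have "\<dots> \<le> 4 * (p * a * b)" using pab by simp
  also have "\<dots> \<le> 4 * (p * (p * a * b))" using p1 ab by simp
  also have "\<dots> \<le> p^2 * (a + b)^2"
  proof -
    have "4 * (a * b) \<le> (a + b)^2" using zero_le_square[of "a - b"] by (simp add: power2_eq_square algebra_simps)
    then have "p^2 * (4 * (a * b)) \<le> p^2 * (a + b)^2" by (intro mult_left_mono) auto
    then show ?thesis by (simp add: power2_eq_square mult_ac)
  qed
  finally have "(2 * A)^2 \<le> (p * (a + b))^2" by (simp add: power_mult_distrib)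
  then show "p * (a + b) \<ge> 2 * A" by (rule power2_le_imp_le) (use p1 ab in auto)
qed

subsection \<open>The stability inequality for homogeneous solutions\<close>

text \<open>h may be singular at 0, but the weight vanishes on the open unit ball, so the product is
  continuous with compact support.\<close>

lemma integrable_radial_weight:
  fixes h :: "real^'n::finite \<Rightarrow> real"
  assumes k: "continuous_on {0<..} k" "\<And>t. t \<notin> {1..R} \<Longrightarrow> k t = 0"
    and h: "continuous_on (-{0}) h"
  shows "integrable lborel (\<lambda>x. k (x \<bullet> x) * h x)"
proof (rule integrable_continuous_compact_support)
  have 1: "continuous_on (-{0}) (\<lambda>x::real^'n. k (x \<bullet> x) * h x)"
    by (intro continuous_on_mult h continuous_on_compose2[OF k(1)] continuous_intros) auto
  have z: "k (x \<bullet> x) = 0" if "norm x < 1" for x :: "real^'n"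
    using that power_strict_mono[of "norm x" 1 2] by (intro k(2)) (simp add: dot_square_norm)
  have 2: "continuous_on (ball 0 1) (\<lambda>x::real^'n. k (x \<bullet> x) * h x)"
    by (rule continuous_on_eq[of _ "\<lambda>_. 0"]) (auto simp: z)
  have "continuous_on (-{0} \<union> ball 0 1) (\<lambda>x::real^'n. k (x \<bullet> x) * h x)"
    by (rule continuous_on_open_Un[OF _ _ 1 2]) auto
  moreover have "-{0} \<union> ball 0 1 = (UNIV :: (real^'n) set)" by auto
  ultimately show "continuous_on UNIV (\<lambda>x::real^'n. k (x \<bullet> x) * h x)" by simp
  show "k (x \<bullet> x) * h x = 0" if "norm x > sqrt (max R 0)" for x :: "real^'n"
  proof -
    have "sqrt (max R 0) < sqrt (x \<bullet> x)" using that by (simp add: norm_eq_sqrt_inner)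
    then have "x \<bullet> x > R" by simp
    then show ?thesis by (simp add: k(2))
  qed
qed

text \<open>The exponent \<gamma> is half of (n-4)/2, as radial factors are functions of t = |x|^2.
  The power t^(-\<gamma>) alone contributes -A t^(-\<gamma>-1), where A = 4 \<gamma> (\<gamma> + 1).
  The terms with derivatives of \<eta> form e; the coefficient of t \<eta>' there is 2n - 8 \<gamma>
  = 8.\<close>

lemma laplacian_test_function:
  fixes f :: "real^'n::finite \<Rightarrow> real" and \<gamma> :: real
  assumes f: "smooth_on (-{0}) f" "homog0 f"
    and \<eta>: "\<And>t. (\<eta> has_real_derivative \<eta>' t) (at t)" "\<And>t. (\<eta>' has_real_derivative \<eta>'' t) (at t)"
    and \<gamma>: "\<gamma> = (real CARD('n) - 4) / 4" and x: "x \<noteq> 0"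
  defines "A \<equiv> real CARD('n) * (real CARD('n) - 4) / 4"
    and "e \<equiv> \<lambda>t. 4 * t^2 * \<eta>'' t + 8 * t * \<eta>' t"
  shows "laplacian (\<lambda>x. ((x \<bullet> x) powr (- \<gamma>) * \<eta> (x \<bullet> x)) * f x) x =
     (x \<bullet> x) powr (- \<gamma> - 1) * (\<eta> (x \<bullet> x) * (Tl f x - A * f x) + e (x \<bullet> x) * f x)"
proof -
  define H' where "H' t = (- \<gamma>) * t powr (- \<gamma> - 1) * \<eta> t + \<eta>' t * t powr (- \<gamma>)" for t
  define H'' where "H'' t = ((- \<gamma>) * ((- \<gamma> - 1) * t powr (- \<gamma> - 1 - 1)) * \<eta> t + \<eta>' t * ((- \<gamma>) * t powr (- \<gamma> - 1)))
     + (\<eta>'' t * t powr (- \<gamma>) + ((- \<gamma>) * t powr (- \<gamma> - 1)) * \<eta>' t)" for t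
  have pw: "((\<lambda>t. t powr c) has_real_derivative c * t powr (c - 1)) (at t)" if "t > 0" for c t :: real
    using that by (auto intro!: derivative_eq_intros)
  have d1: "((\<lambda>t. t powr (- \<gamma>) * \<eta> t) has_real_derivative H' t) (at t)" if "t > 0" for t
    unfolding H'_def by (rule DERIV_mult[OF pw[OF that] \<eta>(1)])
  have d2: "(H' has_real_derivative H'' t) (at t)" if "t > 0" for t
    unfolding H'_def H''_def
    by (rule DERIV_add[OF DERIV_mult[OF DERIV_cmult[OF pw[OF that]] \<eta>(1)] DERIV_mult[OF \<eta>(2) pw[OF that]]])
  have n: "real CARD('n) = 4 * \<gamma> + 4" unfolding \<gamma> by (simp add: diff_divide_distrib right_diff_distrib)
  define \<rho> where "\<rho> = x \<bullet> x"
  have \<rho>: "\<rho> > 0" using x by (simp add: \<rho>_def)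
  define P where "P = \<rho> powr (- \<gamma> - 1)"
  have P1: "\<rho> powr (- \<gamma>) = \<rho> * P"
    using \<rho> powr_add[of \<rho> 1 "- \<gamma> - 1"] by (simp add: P_def)
  have P2: "\<rho> powr (- \<gamma> - 1 - 1) = P / \<rho>"
    using \<rho> powr_diff[of \<rho> "- \<gamma> - 1" 1] by (simp add: P_def)
  have coef: "4 * \<rho> * H'' \<rho> + 2 * real CARD('n) * H' \<rho> = P * (e \<rho> - A * \<eta> \<rho>)"
    unfolding H''_def H'_def P1 P2 P_def[symmetric] e_def A_def n
    using \<rho> by (simp add: field_simps power2_eq_square)
  have l: "laplacian f x = Tl f x / \<rho>" using \<rho> by (simp add: Tl_def \<rho>_def)
  have "laplacian (\<lambda>x. ((x \<bullet> x) powr (- \<gamma>) * \<eta> (x \<bullet> x)) * f x) x =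
      (\<rho> powr (- \<gamma>) * \<eta> \<rho>) * laplacian f x + (4 * \<rho> * H'' \<rho> + 2 * real CARD('n) * H' \<rho>) * f x"
    unfolding \<rho>_def by (rule laplacian_radial_mult[OF f d1 d2 x])
  also have "\<dots> = P * (\<eta> \<rho> * (Tl f x - A * f x) + e \<rho> * f x)"
    unfolding coef l P1 using \<rho> by (simp add: algebra_simps)
  finally show ?thesis unfolding P_def \<rho>_def .
qed

lemma norm_powr_inner: "norm x powr c = (x \<bullet> x) powr (c / 2)"
  by (simp add: norm_eq_sqrt_inner powr_half_sqrt[symmetric] powr_powr)

lemma vnorm_scale:
  assumes "c \<ge> 0" "\<And>i. i < m \<Longrightarrow> u i x = c * f i y"
  shows "vnorm m u x = c * vnorm m f y"
proof -
  have "(\<Sum>i<m. (u i x)^2) = c^2 * (\<Sum>i<m. (f i y)^2)"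
    using assms(2) by (simp add: power_mult_distrib sum_distrib_left)
  then show ?thesis using assms(1) by (simp add: vnorm_def real_sqrt_mult)
qed

lemma vnorm_nonneg: "vnorm m f x \<ge> 0"
  by (simp add: vnorm_def sum_nonneg)

lemma vnorm_power2: "(vnorm m f x)^2 = (\<Sum>i<m. (f i x)^2)"
  by (simp add: vnorm_def sum_nonneg)

lemma vnorm_ge: "i < m \<Longrightarrow> (f i x)^2 \<le> (vnorm m f x)^2"
  unfolding vnorm_power2 by (rule member_le_sum) auto

text \<open>Applied with q = p - 1 and F = |f|: the exponent p - 3 may be negative, so the zeros of
  f are a separate case.\<close>

lemma powr_plus_2: "F \<ge> (0::real) \<Longrightarrow> F powr (q - 2) * (F^2 * F^2) = F powr q * F^2"
proof (cases "F = 0")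
  case False
  assume "F \<ge> 0"
  with False have "F powr q = F powr (q - 2) * F^2"
    using powr_add[of F "q - 2" 2] by (simp add: powr_numeral)
  then show ?thesis by simp
qed simp

text \<open>Stability tested with \<open>\<phi>\<^sub>i = |x|\<^sup>-\<^sup>(\<^sup>n\<^sup>-\<^sup>4\<^sup>)\<^sup>/\<^sup>2 \<eta>(|x|\<^sup>2) f\<^sub>i\<close>: the exponent makes every term homogeneous of degree \<open>-n\<close>.\<close>
lemma stability_radial_test:
  fixes u f :: "nat \<Rightarrow> real^'n::finite \<Rightarrow> real" and p :: real
  assumes stable: "is_stable m p u" and p: "p > 1"
    and f: "\<And>i. i < m \<Longrightarrow> smooth_on (-{0}) (f i)" "\<And>i. i < m \<Longrightarrow> homog0 (f i)"
    and u: "\<And>i x. i < m \<Longrightarrow> x \<noteq> 0 \<Longrightarrow> u i x = norm x powr (- 4 / (p - 1)) * f i x"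
    and \<eta>: "\<And>k. diff_n k UNIV \<eta>" "\<And>t. (\<eta> has_real_derivative \<eta>' t) (at t)"
      "\<And>t. (\<eta>' has_real_derivative \<eta>'' t) (at t)"
      "\<And>t. t \<le> 1 \<Longrightarrow> \<eta> t = 0" "\<And>t. t \<ge> R \<Longrightarrow> \<eta> t = 0"
  defines "A \<equiv> real CARD('n) * (real CARD('n) - 4) / 4"
    and "e \<equiv> \<lambda>t. 4 * t^2 * \<eta>'' t + 8 * t * \<eta>' t"
    and "w \<equiv> \<lambda>t. t powr (- real CARD('n) / 2)"
  shows "p * (\<Sum>i<m. LINT x|lborel. (w (x \<bullet> x) * (\<eta> (x \<bullet> x))^2) * (vnorm m f x powr (p - 1) * (f i x)^2))
    \<le> (\<Sum>i<m. LINT x|lborel. w (x \<bullet> x) * (\<eta> (x \<bullet> x) * (Tl (f i) x - A * f i x) + e (x \<bullet> x) * f i x)^2)"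
proof -
  define \<gamma> where "\<gamma> = (real CARD('n) - 4) / 4"
  define k where "k t = w t * (\<eta> t)^2" for t
  define F where "F x = vnorm m f x" for x
  define \<phi> where "\<phi> i x = ((x \<bullet> x) powr (- \<gamma>) * \<eta> (x \<bullet> x)) * f i x" for i x
  have c\<eta>: "continuous_on T \<eta>" for T by (rule diff_n_UNIV_continuous[OF \<eta>(1)])
  have ck: "continuous_on {0<..} k"
    unfolding k_def w_def by (intro continuous_intros c\<eta>) auto
  have k0: "k t = 0" if "t \<notin> {1..R}" for t using \<eta>(4)[of t] \<eta>(5)[of t] that by (auto simp: k_def)
  have cf: "i < m \<Longrightarrow> continuous_on (-{0}) (f i)" for i by (rule smooth_on_continuous[OF f(1)])
  have cF: "continuous_on (-{0}) F"
    unfolding F_def vnorm_def by (intro continuous_intros) (use cf in auto)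
  have cV: "continuous_on (-{0}) (\<lambda>x. F x powr (p - 1))"
    by (rule continuous_on_powr'[OF cF continuous_on_const]) (use p in \<open>auto simp: F_def vnorm_nonneg\<close>)
  have in1: "norm x < 1 \<Longrightarrow> x \<bullet> x \<le> 1" for x :: "real^'n"
    by (simp add: dot_square_norm power_le_one)
  have \<phi>in: "norm x < 1 \<Longrightarrow> \<phi> i x = 0" for i x using in1 \<eta>(4) by (simp add: \<phi>_def)
  have \<phi>out: "norm x > sqrt (max R 0) \<Longrightarrow> \<phi> i x = 0" for i x
  proof -
    assume "norm x > sqrt (max R 0)"
    then have "sqrt (max R 0) < sqrt (x \<bullet> x)" by (simp add: norm_eq_sqrt_inner)
    then have "x \<bullet> x \<ge> R" by simp
    then show "\<phi> i x = 0" using \<eta>(5) by (simp add: \<phi>_def)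
  qed
  have test: "cc_smooth_punctured (\<phi> i)" if "i < m" for i
  proof -
    have "smooth_on (-{0}) (\<lambda>x::real^'n. ((x \<bullet> x) powr (- \<gamma>) * \<eta> (x \<bullet> x)))"
      by (intro smooth_on_mult smooth_on_radial diff_n_powr smooth_on_compose[OF \<eta>(1)] smooth_on_inner) auto
    then have "smooth_on (-{0}) (\<phi> i)"
      unfolding \<phi>_def by (rule smooth_on_mult[OF _ f(1)[OF that]])
    then have 1: "smooth_on UNIV (\<phi> i)" by (rule smooth_on_extend_0[of _ 1]) (auto simp: \<phi>in)
    have "{x. \<phi> i x \<noteq> 0} \<subseteq> cball 0 (sqrt (max R 0)) - ball 0 1"
    proof
      fix x assume "x \<in> {x. \<phi> i x \<noteq> 0}"
      then have "\<not> norm x < 1" "\<not> norm x > sqrt (max R 0)" using \<phi>in \<phi>out by blast+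
      then show "x \<in> cball 0 (sqrt (max R 0)) - ball 0 1" by simp
    qed
    moreover have "closed (cball 0 (sqrt (max R 0)) - ball (0::real^'n) 1)"
      by (intro closed_Diff) auto
    ultimately have sub: "closure {x. \<phi> i x \<noteq> 0} \<subseteq> cball 0 (sqrt (max R 0)) - ball 0 1"
      by (rule closure_minimal)
    then have "compact (closure {x. \<phi> i x \<noteq> 0})"
      by (intro compact_closure[THEN iffD2]) (meson bounded_cball bounded_subset closure_subset Diff_subset order_trans)
    with 1 sub show ?thesis by (auto simp: cc_smooth_punctured_def)
  qed
  \<comment> \<open>Degree count: |x|^(-4) from |u|^(p-1) and |x|^(-(n-4)) from the square of the
    test function give |x|^(-n). At x = 0 both sides are 0, as \<open>0 powr c = 0\<close>.\<close>
  have hom: "norm x powr (- 4 / (p - 1) * (p - 1)) * ((x \<bullet> x) powr (- \<gamma>))^2 = w (x \<bullet> x)" for x :: "real^'n"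
  proof (cases "x = 0")
    case False
    have e4: "- 4 / (p - 1) * (p - 1) = - 4" using nonzero_eq_divide_eq[of "p - 1" "- 4 / (p - 1)" "- 4"] p by auto
    show ?thesis using False unfolding e4 norm_powr_inner w_def \<gamma>_def
      by (simp add: power2_eq_square powr_add[symmetric] diff_divide_distrib)
  qed (simp add: w_def)
  have vu: "vnorm m u x = norm x powr (- 4 / (p - 1)) * F x" if "x \<noteq> 0" for x
    unfolding F_def by (rule vnorm_scale) (use u that in auto)
  have t1: "vnorm m u x powr (p - 1) * (\<phi> i x)^2 = k (x \<bullet> x) * (F x powr (p - 1) * (f i x)^2)" for i x
  proof (cases "x = 0")
    case True
    then show ?thesis using \<phi>in[of x i] k0 by simp
  next
    case False
    have "vnorm m u x powr (p - 1) = norm x powr (- 4 / (p - 1) * (p - 1)) * F x powr (p - 1)"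
      unfolding vu[OF False] by (simp add: powr_mult F_def vnorm_nonneg powr_powr)
    then show ?thesis unfolding k_def hom[symmetric] \<phi>_def
      by (simp add: power_mult_distrib mult_ac)
  qed
  have t2: "vnorm m u x powr (p - 3) * u i x * u j x * \<phi> i x * \<phi> j x
      = k (x \<bullet> x) * (F x powr (p - 3) * ((f i x)^2 * (f j x)^2))" if "i < m" "j < m" for i j x
  proof (cases "x = 0")
    case True
    then show ?thesis using \<phi>in[of x] k0 by simp
  next
    case False
    define c where "c = norm x powr (- 4 / (p - 1))"
    have "c powr (p - 3) * (c * c) = c powr (p - 1)"
      using powr_add[of c "p - 3" 2] False by (simp add: c_def powr_numeral power2_eq_square)
    also have "\<dots> = norm x powr (- 4 / (p - 1) * (p - 1))" by (simp add: c_def powr_powr)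
    finally have c: "w (x \<bullet> x) = c powr (p - 3) * (c * c) * ((x \<bullet> x) powr (- \<gamma>))^2"
      using hom[of x] by simp
    have "vnorm m u x powr (p - 3) = c powr (p - 3) * F x powr (p - 3)"
      unfolding vu[OF False] c_def by (simp add: powr_mult F_def vnorm_nonneg)
    then show ?thesis unfolding k_def c \<phi>_def u[OF that(1) False] u[OF that(2) False] c_def[symmetric]
      by (simp add: power2_eq_square mult_ac)
  qed
  have i1: "integrable lborel (\<lambda>x. k (x \<bullet> x) * (F x powr (p - 1) * (f i x)^2))" if "i < m" for i
    by (rule integrable_radial_weight[OF ck]) (erule k0, intro continuous_intros cV cf that)
  have iF: "integrable lborel (\<lambda>x. k (x \<bullet> x) * (F x powr (p - 1) * (F x)^2))"
    by (rule integrable_radial_weight[OF ck]) (erule k0, intro continuous_intros cV cF)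
  have kpos: "k t \<ge> 0" for t by (simp add: k_def w_def)
  have meas: "g \<in> borel_measurable borel" if "continuous_on (-{0}) g" for g :: "real^'n \<Rightarrow> real"
    by (rule borel_measurable_continuous_countable_exceptions[of "{0}"]) (use that in auto)
  \<comment> \<open>|f|^(p-3) may be discontinuous where f vanishes, so integrability comes from
    domination by the integrand with |f|^(p-1) |f|^2, which is continuous off the origin.\<close>
  have i2: "integrable lborel (\<lambda>x. k (x \<bullet> x) * (F x powr (p - 3) * ((f i x)^2 * (f j x)^2)))" if "i < m" "j < m" for i j
  proof (rule Bochner_Integration.integrable_bound[OF iF])
    have [measurable]: "(\<lambda>x::real^'n. k (x \<bullet> x)) \<in> borel_measurable borel"
      by (rule meas, rule continuous_on_compose2[OF ck]) (auto intro!: continuous_intros)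
    have [measurable]: "F \<in> borel_measurable borel" "f i \<in> borel_measurable borel" "f j \<in> borel_measurable borel"
      using meas[OF cF] meas[OF cf] that by auto
    show "(\<lambda>x. k (x \<bullet> x) * (F x powr (p - 3) * ((f i x)^2 * (f j x)^2))) \<in> borel_measurable lborel" by simp
    have "F x powr (p - 3) * ((f i x)^2 * (f j x)^2) \<le> F x powr (p - 1) * (F x)^2" for x
    proof -
      have "(f i x)^2 * (f j x)^2 \<le> (F x)^2 * (F x)^2"
        unfolding F_def by (intro mult_mono vnorm_ge that) auto
      then have "F x powr (p - 3) * ((f i x)^2 * (f j x)^2) \<le> F x powr (p - 3) * ((F x)^2 * (F x)^2)"
        by (rule mult_left_mono) simp
      also have "\<dots> = F x powr (p - 1) * (F x)^2"
        using powr_plus_2[of "F x" "p - 1"] vnorm_nonneg[of m f x] by (simp add: F_def)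
      finally show ?thesis .
    qed
    then show "AE x in lborel. norm (k (x \<bullet> x) * (F x powr (p - 3) * ((f i x)^2 * (f j x)^2)))
        \<le> norm (k (x \<bullet> x) * (F x powr (p - 1) * (F x)^2))"
      using kpos by (intro always_eventually allI) (simp add: abs_mult mult_left_mono)
  qed
  \<comment> \<open>The double sum collapses because the f_i^2 f_j^2 add up to |f|^4. With its
    coefficient p - 1 it joins the first term of the stability inequality and yields the factor
    p.\<close>
  have "(\<Sum>i<m. \<Sum>j<m. LINT x|lborel. k (x \<bullet> x) * (F x powr (p - 3) * ((f i x)^2 * (f j x)^2)))
      = (LINT x|lborel. (\<Sum>i<m. \<Sum>j<m. k (x \<bullet> x) * (F x powr (p - 3) * ((f i x)^2 * (f j x)^2))))"
  proof -
    have "(\<Sum>i<m. \<Sum>j<m. LINT x|lborel. k (x \<bullet> x) * (F x powr (p - 3) * ((f i x)^2 * (f j x)^2)))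
        = (\<Sum>i<m. LINT x|lborel. (\<Sum>j<m. k (x \<bullet> x) * (F x powr (p - 3) * ((f i x)^2 * (f j x)^2))))"
      by (intro sum.cong refl Bochner_Integration.integral_sum[symmetric] i2) auto
    also have "\<dots> = (LINT x|lborel. (\<Sum>i<m. \<Sum>j<m. k (x \<bullet> x) * (F x powr (p - 3) * ((f i x)^2 * (f j x)^2))))"
      by (intro Bochner_Integration.integral_sum[symmetric] Bochner_Integration.integrable_sum i2) auto
    finally show ?thesis .
  qed
  also have "\<dots> = (LINT x|lborel. k (x \<bullet> x) * (F x powr (p - 3) * ((F x)^2 * (F x)^2)))"
  proof -
    have "(F x)^2 * (F x)^2 = (\<Sum>i<m. \<Sum>j<m. (f i x)^2 * (f j x)^2)" for x
      unfolding F_def vnorm_power2 by (rule sum_product)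
    then show ?thesis by (simp only: sum_distrib_left)
  qed
  also have "\<dots> = (LINT x|lborel. k (x \<bullet> x) * (F x powr (p - 1) * (F x)^2))"
    using powr_plus_2[of "F x" "p - 1" for x] vnorm_nonneg[of m f] by (simp add: F_def[symmetric])
  also have "\<dots> = (LINT x|lborel. (\<Sum>i<m. k (x \<bullet> x) * (F x powr (p - 1) * (f i x)^2)))"
    unfolding sum_distrib_left[symmetric] by (simp add: F_def vnorm_power2)
  also have "\<dots> = (\<Sum>i<m. LINT x|lborel. k (x \<bullet> x) * (F x powr (p - 1) * (f i x)^2))"
    by (intro Bochner_Integration.integral_sum i1) auto
  finally have cross: "(\<Sum>i<m. \<Sum>j<m. LINT x|lborel. k (x \<bullet> x) * (F x powr (p - 3) * ((f i x)^2 * (f j x)^2)))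
      = (\<Sum>i<m. LINT x|lborel. k (x \<bullet> x) * (F x powr (p - 1) * (f i x)^2))" .
  have lap: "(laplacian (\<phi> i) x)^2 = w (x \<bullet> x) * (\<eta> (x \<bullet> x) * (Tl (f i) x - A * f i x) + e (x \<bullet> x) * f i x)^2"
    if "i < m" for i x
  proof (cases "x = 0")
    case True
    have "laplacian (\<phi> i) x = laplacian (\<lambda>_. 0) x"
      by (rule laplacian_cong[of "ball 0 1"]) (use True \<phi>in in auto)
    then have "laplacian (\<phi> i) x = 0" by (simp add: laplacian_def partial_def)
    then show ?thesis using True by (simp add: w_def)
  next
    case False
    have "((x \<bullet> x) powr (- \<gamma> - 1))^2 = w (x \<bullet> x)"
      using False by (simp add: w_def power2_eq_square powr_add[symmetric] \<gamma>_def field_simps)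
    then show ?thesis
      unfolding \<phi>_def laplacian_test_function[OF f(1)[OF that] f(2)[OF that] \<eta>(2,3) \<gamma>_def False]
        power_mult_distrib A_def e_def by simp
  qed
  have "(\<Sum>i<m. LINT x|lborel. vnorm m u x powr (p - 1) * (\<phi> i x)^2)
      + (p - 1) * (\<Sum>i<m. \<Sum>j<m. LINT x|lborel. vnorm m u x powr (p - 3) * u i x * u j x * \<phi> i x * \<phi> j x)
      \<le> (\<Sum>i<m. LINT x|lborel. (laplacian (\<phi> i) x)^2)"
    using stable test unfolding is_stable_def by blast
  then show ?thesis
    by (simp add: t1 t2 lap cross) (simp add: k_def F_def algebra_simps)
qed

section \<open>The equation for the angular part\<close>

text \<open>Each Laplacian lowers the degree of homogeneity by 2 and acts as T minus a constant:
  degree -\<alpha> yields a, then degree -(\<alpha> + 2) yields b.\<close>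

lemma sphere_equation:
  fixes f :: "real^'n::finite \<Rightarrow> real" and \<alpha> :: real
  assumes f: "smooth_on (-{0}) f" "homog0 f"
    and u: "\<And>x. x \<noteq> 0 \<Longrightarrow> u x = norm x powr (- \<alpha>) * f x" and x: "x \<noteq> 0"
  defines "a \<equiv> \<alpha> * (real CARD('n) - 2 - \<alpha>)" and "b \<equiv> (\<alpha> + 2) * (real CARD('n) - 4 - \<alpha>)"
  defines "g \<equiv> \<lambda>x. Tl f x - a * f x"
  shows "bilaplacian u x = norm x powr (- \<alpha> - 4) * (Tl g x - b * g x)"
proof -
  have pw: "((\<lambda>t. t powr d) has_real_derivative d * t powr (d - 1)) (at t)"
      "((\<lambda>t. d * t powr (d - 1)) has_real_derivative d * ((d - 1) * t powr (d - 1 - 1))) (at t)" if "t > 0" for d t :: real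
    using that by (auto intro!: derivative_eq_intros)
  have lp: "laplacian (\<lambda>x. norm x powr (- \<delta>) * h x) x
      = norm x powr (- \<delta> - 2) * (Tl h x - \<delta> * (real CARD('n) - 2 - \<delta>) * h x)"
    if h: "smooth_on (-{0}) h" "homog0 h" and x: "x \<noteq> 0" for h :: "real^'n \<Rightarrow> real" and \<delta> x
  proof -
    define \<rho> where "\<rho> = x \<bullet> x"
    have \<rho>: "\<rho> > 0" using x by (simp add: \<rho>_def)
    define P where "P = \<rho> powr (- \<delta> / 2 - 1)"
    have P1: "\<rho> powr (- \<delta> / 2) = \<rho> * P"
      using \<rho> powr_add[of \<rho> 1 "- \<delta> / 2 - 1"] by (simp add: P_def)
    have P2: "\<rho> powr (- \<delta> / 2 - 1 - 1) = P / \<rho>"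
      using \<rho> powr_diff[of \<rho> "- \<delta> / 2 - 1" 1] by (simp add: P_def)
    have P3: "norm x powr (- \<delta> - 2) = P"
      unfolding norm_powr_inner P_def \<rho>_def by (simp add: diff_divide_distrib)
    have l: "laplacian h x = Tl h x / \<rho>" using \<rho> by (simp add: Tl_def \<rho>_def)
    have "laplacian (\<lambda>x. (x \<bullet> x) powr (- \<delta> / 2) * h x) x = \<rho> powr (- \<delta> / 2) * laplacian h x +
        (4 * \<rho> * (- \<delta> / 2 * ((- \<delta> / 2 - 1) * \<rho> powr (- \<delta> / 2 - 1 - 1))) +
          2 * real CARD('n) * (- \<delta> / 2 * \<rho> powr (- \<delta> / 2 - 1))) * h x"
      unfolding \<rho>_def by (rule laplacian_radial_mult[OF h pw x])
    also have "\<dots> = norm x powr (- \<delta> - 2) * (Tl h x - \<delta> * (real CARD('n) - 2 - \<delta>) * h x)"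
      unfolding P1 P2 P3 P_def[symmetric] l using \<rho> by (simp add: field_simps)
    finally have "laplacian (\<lambda>x. (x \<bullet> x) powr (- \<delta> / 2) * h x) x
      = norm x powr (- \<delta> - 2) * (Tl h x - \<delta> * (real CARD('n) - 2 - \<delta>) * h x)" .
    then show ?thesis unfolding norm_powr_inner by simp
  qed
  have "smooth_on (-{0}) g" "homog0 g"
    unfolding g_def by (intro homog0_diff_const_mult homog0_Tl f)+
  note g = this
  have op: "open (-{0::real^'n})" by auto
  have "laplacian u y = norm y powr (- (\<alpha> + 2)) * g y" if "y \<noteq> 0" for y
  proof -
    have "laplacian u y = laplacian (\<lambda>x. norm x powr (- \<alpha>) * f x) y"
      by (rule laplacian_cong[OF op]) (use u that in auto)
    then show ?thesis unfolding lp[OF f that] by (simp add: g_def a_def)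
  qed
  then have "bilaplacian u x = laplacian (\<lambda>x. norm x powr (- (\<alpha> + 2)) * g x) x"
    unfolding bilaplacian_def by (intro laplacian_cong[OF op]) (use x in auto)
  also have "\<dots> = norm x powr (- \<alpha> - 4) * (Tl g x - b * g x)"
    unfolding lp[OF g x] b_def by (simp add: algebra_simps)
  finally show ?thesis .
qed

section \<open>Growth of the weighted mass\<close>

lemma measure_cball_scale:
  "r \<ge> 0 \<Longrightarrow> measure lborel (cball (c::real^'n::finite) r) = unit_ball_vol (real CARD('n)) * r ^ CARD('n)"
  using content_cball[of r c] by simp

lemma measure_ball_scale:
  "r \<ge> 0 \<Longrightarrow> measure lborel (ball (c::real^'n::finite) r) = unit_ball_vol (real CARD('n)) * r ^ CARD('n)"
  using content_ball[of r c] by simp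

lemma radial_weight_power:
  fixes x :: "real^'n::finite"
  assumes "x \<noteq> 0"
  shows "(x \<bullet> x) powr (- real CARD('n) / 2) = 1 / norm x ^ CARD('n)"
proof -
  have "(x \<bullet> x) powr (- real CARD('n) / 2) = norm x powr (- real CARD('n))"
    by (simp add: norm_powr_inner)
  also have "\<dots> = 1 / norm x ^ CARD('n)"
    using assms by (simp add: powr_minus powr_realpow divide_inverse)
  finally show ?thesis .
qed

text \<open>Each dyadic-type shell \<open>|x| \<approx> 4\<^sup>j\<close> contributes the same positive amount, because the weighted
  integrand is homogeneous of degree \<open>-n\<close>.\<close>
lemma weighted_mass_unbounded:
  fixes f :: "real^'n::finite \<Rightarrow> real"
  assumes f: "continuous_on (-{0}) f" "homog0 f" and \<theta>: "norm \<theta> = 1" "f \<theta> \<noteq> 0"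
  shows "\<exists>\<kappa>>0. \<forall>J k R. continuous_on {0<..} k \<longrightarrow> (\<forall>t. t \<notin> {1..R} \<longrightarrow> k t = 0) \<longrightarrow>
      (\<forall>t. k t \<ge> 0) \<longrightarrow> (\<forall>t. 2 \<le> t \<and> t \<le> (4 ^ Suc J)^2 \<longrightarrow> k t = t powr (- real CARD('n) / 2)) \<longrightarrow>
      \<kappa> * real J \<le> (LINT x|lborel. k (x \<bullet> x) * (f x)^2)"
proof -
  \<comment> \<open>Near \<theta> the values of |f| stay above half of |f(\<theta>)|;
    \<open>\<delta>\<close> is the square of that half.\<close>
  define \<delta> where "\<delta> = (f \<theta>)^2 / 4"
  have "\<delta> > 0" using \<theta> by (simp add: \<delta>_def)
  have "\<theta> \<noteq> 0" using \<theta>(1) by auto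
  then have "isCont f \<theta>" using f(1) using continuous_on_eq_continuous_at[OF open_Compl[OF closed_singleton], of 0 f] by auto
  then obtain s0 where s0: "s0 > 0" "\<And>y. dist y \<theta> < s0 \<Longrightarrow> dist (f y) (f \<theta>) < \<bar>f \<theta>\<bar> / 2"
    using \<theta>(2) unfolding continuous_at_eps_delta by (metis half_gt_zero zero_less_abs_iff)
  \<comment> \<open>A radius of at most 1/4 puts the dilated ball around 4^j \<theta> into the shell
    3/4 < |x| / 4^j < 5/4, and these shells are disjoint.\<close>
  define s where "s = min s0 (1/4)"
  have s: "s > 0" "s \<le> 1/4" "s \<le> s0" using s0 by (auto simp: s_def)
  have lower: "\<delta> \<le> (f y)^2" if "dist y \<theta> < s" for y
  proof -
    have "\<bar>f y - f \<theta>\<bar> < \<bar>f \<theta>\<bar> / 2" using s0(2)[of y] that s(3) by (simp add: dist_real_def)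
    then have "\<bar>f y\<bar> \<ge> \<bar>f \<theta>\<bar> / 2" by linarith
    then have "(\<bar>f \<theta>\<bar> / 2)^2 \<le> \<bar>f y\<bar>^2" by (intro power_mono) auto
    then show ?thesis by (simp add: \<delta>_def power_divide)
  qed
  let ?n = "CARD('n)"
  define V where "V = unit_ball_vol (real ?n)"
  have V: "V > 0" by (simp add: V_def)
  define B where "B j = ball (4 ^ j *\<^sub>R \<theta>) (4 ^ j * s)" for j :: nat
  \<comment> \<open>A lower bound for |x|^(-n) f(x)^2 on \<open>B j\<close>, where |x| <= 2 * 4^j.
    Its product with the volume of \<open>B j\<close> does not depend on j.\<close>
  define c where "c j = \<delta> / (2 * 4 ^ j) ^ ?n" for j :: nat
  have c0: "c j \<ge> 0" for j using \<open>\<delta> > 0\<close> by (simp add: c_def)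
  have nB: "3/4 * 4 ^ j < norm x" "norm x < 5/4 * 4 ^ j" if "x \<in> B j" for j x
  proof -
    have "dist (4 ^ j *\<^sub>R \<theta>) x < 4 ^ j * s" using that by (simp add: B_def)
    also have "\<dots> \<le> 4 ^ j * (1/4)" using s by (intro mult_left_mono) auto
    finally have d: "norm (4 ^ j *\<^sub>R \<theta> - x) < 1/4 * 4 ^ j" by (simp add: dist_norm)
    have "norm (4 ^ j *\<^sub>R \<theta>) = 4 ^ j" using \<theta>(1) by simp
    then show "3/4 * 4 ^ j < norm x" "norm x < 5/4 * 4 ^ j"
      using d norm_triangle_ineq2[of "4 ^ j *\<^sub>R \<theta>" x] norm_triangle_ineq2[of x "4 ^ j *\<^sub>R \<theta>"]
      by (auto simp: norm_minus_commute)
  qed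
  have disj: "i = j" if "x \<in> B i" "x \<in> B j" for i j x
  proof -
    have *: False if "i < j" "x \<in> B i" "x \<in> B j" for i j
    proof -
      have "(4::real) ^ Suc i \<le> 4 ^ j" using that(1) by (intro power_increasing) auto
      then show False using nB[OF that(2)] nB[OF that(3)] zero_less_power[of "4::real" i] by simp
    qed
    then show ?thesis using that by (metis linorder_neqE_nat)
  qed
  show ?thesis
  proof (intro exI[of _ "\<delta> * V * (s / 2) ^ ?n"] conjI allI impI)
    show "\<delta> * V * (s / 2) ^ ?n > 0" using \<open>\<delta> > 0\<close> V s by simp
    fix J :: nat and k :: "real \<Rightarrow> real" and R :: real
    assume "continuous_on {0<..} k" "\<forall>t. t \<notin> {1..R} \<longrightarrow> k t = 0" "\<forall>t. k t \<ge> 0"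
      "\<forall>t. 2 \<le> t \<and> t \<le> (4 ^ Suc J)^2 \<longrightarrow> k t = t powr (- real ?n / 2)"
    then have k: "continuous_on {0<..} k" "\<And>t. t \<notin> {1..R} \<Longrightarrow> k t = 0" "\<And>t. k t \<ge> 0"
      "\<And>t. 2 \<le> t \<Longrightarrow> t \<le> (4 ^ Suc J)^2 \<Longrightarrow> k t = t powr (- real ?n / 2)" by blast+
    \<comment> \<open>A sum of scaled indicators below the integrand. Starting at j = 1 gives |x| >
      3, beyond the inner collar, and |x| < 5/4 * 4^J stays below 4^(J+1), inside the
      plateau.\<close>
    define L where "L x = (\<Sum>j\<in>{1..J}. c j * indicator (B j) x)" for x :: "real^'n"
    have iB: "integrable lborel (\<lambda>x. c j * indicator (B j) x :: real)" for j
      unfolding B_def by (intro integrable_mult_right integrable_real_indicator)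
        (simp_all add: emeasure_bounded_finite[OF bounded_ball, unfolded infinity_ennreal_def])
    have mB: "c j * measure lborel (B j) = \<delta> * V * (s / 2) ^ ?n" for j
    proof -
      have "measure lborel (B j) = V * (4 ^ j * s) ^ ?n"
        unfolding B_def V_def by (rule measure_ball_scale) (use s in simp)
      moreover have "(4 ^ j * s) ^ ?n / (2 * 4 ^ j) ^ ?n = (s / 2) ^ ?n"
        unfolding power_divide[symmetric] by simp
      ultimately show ?thesis unfolding c_def by (metis times_divide_eq_left times_divide_eq_right mult.assoc mult.commute)
    qed
    have "(LINT x|lborel. L x) = (\<Sum>j\<in>{1..J}. c j * measure lborel (B j))"
      unfolding L_def using iB by (subst Bochner_Integration.integral_sum) (auto simp: B_def)
    also have "\<dots> = \<delta> * V * (s / 2) ^ ?n * real J" by (simp add: mB)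
    finally have IL: "(LINT x|lborel. L x) = \<delta> * V * (s / 2) ^ ?n * real J" .
    have "L x \<le> k (x \<bullet> x) * (f x)^2" for x
    proof (cases "\<exists>j\<in>{1..J}. x \<in> B j")
      case False
      then have "L x = 0" by (auto simp: L_def)
      then show ?thesis using k(3) by simp
    next
      case True
      then obtain j where j: "j \<in> {1..J}" "x \<in> B j" by blast
      have "L x = (\<Sum>i\<in>{1..J}. if i = j then c j else 0)"
        unfolding L_def using disj j(2) by (intro sum.cong) (auto simp: indicator_def)
      also have "\<dots> = c j" using j by simp
      finally have Lx: "L x = c j" .
      have p4: "(4::real) ^ j \<ge> 4" using power_increasing[of 1 j "4::real"] j by simp
      have x0: "x \<noteq> 0" "norm x \<ge> 2" using nB(1)[OF j(2)] p4 by auto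
      have "norm x \<le> 4 ^ Suc J"
      proof -
        have "norm x \<le> 4 ^ Suc j" using nB(2)[OF j(2)] p4 by simp
        also have "(4::real) ^ Suc j \<le> 4 ^ Suc J" using j by (intro power_increasing) auto
        finally show ?thesis .
      qed
      then have "x \<bullet> x \<le> (4 ^ Suc J)^2" unfolding dot_square_norm by (intro power_mono) auto
      moreover have "x \<bullet> x \<ge> 2" using power_mono[OF x0(2), of 2] by (simp add: dot_square_norm)
      ultimately have kx: "k (x \<bullet> x) = 1 / norm x ^ ?n" using k(4) radial_weight_power[OF x0(1)] by simp
      have "norm x ^ ?n \<le> (2 * 4 ^ j) ^ ?n" using nB(2)[OF j(2)] p4 by (intro power_mono) auto
      then have w: "1 / (2 * 4 ^ j) ^ ?n \<le> 1 / norm x ^ ?n" using x0(1) by (intro divide_left_mono) auto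
      have "dist (inverse (4 ^ j) *\<^sub>R x) \<theta> = inverse (4 ^ j) * dist x (4 ^ j *\<^sub>R \<theta>)"
      proof -
        have "inverse (4 ^ j) *\<^sub>R x - \<theta> = inverse (4 ^ j) *\<^sub>R (x - 4 ^ j *\<^sub>R \<theta>)"
          by (simp add: scaleR_diff_right)
        then show ?thesis by (simp add: dist_norm)
      qed
      also have "\<dots> < s" using j(2) by (simp add: B_def dist_commute field_simps)
      finally have "\<delta> \<le> (f (inverse (4 ^ j) *\<^sub>R x))^2" by (rule lower)
      also have "f (inverse (4 ^ j) *\<^sub>R x) = f x" using f(2) x0 unfolding homog0_def by simp
      finally have "1 / (2 * 4 ^ j) ^ ?n * \<delta> \<le> 1 / norm x ^ ?n * (f x)^2"
        using w \<open>\<delta> > 0\<close> by (intro mult_mono) auto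
      then show ?thesis unfolding Lx kx c_def by simp
    qed
    moreover have "integrable lborel L" unfolding L_def using iB by (intro Bochner_Integration.integrable_sum) auto
    moreover have "integrable lborel (\<lambda>x. k (x \<bullet> x) * (f x)^2)"
      by (rule integrable_radial_weight[OF k(1)]) (erule k(2), intro continuous_intros f(1))
    ultimately have "(LINT x|lborel. L x) \<le> (LINT x|lborel. k (x \<bullet> x) * (f x)^2)"
      by (intro integral_mono)
    then show "\<delta> * V * (s / 2) ^ ?n * real J \<le> (LINT x|lborel. k (x \<bullet> x) * (f x)^2)" using IL by simp
  qed
qed

section \<open>Integration by parts, the energy inequality and its error term\<close>

text \<open>The factor |x|^2 of T is absorbed into the weight. The right side shows that T is
  symmetric on 0-homogeneous functions, and for f = g and k >= 0 that the integral of f T f is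
  nonpositive.\<close>

lemma integral_Tl_by_parts:
  fixes f g :: "real^'n::finite \<Rightarrow> real"
  assumes f: "smooth_on (-{0}) f" and g: "smooth_on (-{0}) g" "homog0 g"
    and k: "\<And>n. diff_n n {0<..} k" "\<And>t. t \<le> 1 \<Longrightarrow> k t = 0" "\<And>t. t \<ge> R \<Longrightarrow> k t = 0" "R \<ge> 1"
  shows "(LINT x|lborel. k (x \<bullet> x) * (f x * Tl g x)) =
    - (LINT x|lborel. (k (x \<bullet> x) * (x \<bullet> x)) * (\<Sum>i\<in>UNIV. partial i f x * partial i g x))"
proof -
  define K where "K t = k t * t" for t
  have dK: "diff_n n {0<..} K" for n
    unfolding K_def by (intro diff_n_mult k diff_n_ident)
  have cK: "continuous_on {0<..} K" by (rule diff_n_continuous[OF dK])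
  have K0: "t \<le> 1 \<Longrightarrow> K t = 0" "t \<ge> R \<Longrightarrow> K t = 0" for t using k by (auto simp: K_def)
  have K0': "K t = 0" if "t \<notin> {1..R}" for t using K0[of t] that by auto
  have i1: "integrable lborel (\<lambda>x. K (x \<bullet> x) * (f x * laplacian g x))"
    by (rule integrable_radial_weight[OF cK])
      (erule K0', intro continuous_intros smooth_on_continuous[OF f] smooth_on_continuous[OF smooth_on_laplacian[OF g(1)]])
  have i2: "integrable lborel (\<lambda>x. K (x \<bullet> x) * (\<Sum>i\<in>UNIV. partial i f x * partial i g x))"
    by (rule integrable_radial_weight[OF cK])
      (erule K0', intro continuous_intros smooth_on_continuous[OF smooth_on_partial[OF f]] smooth_on_continuous[OF smooth_on_partial[OF g(1)]])
  have "0 = (LINT x|lborel. K (x \<bullet> x) * (f x * laplacian g x + (\<Sum>i\<in>UNIV. partial i f x * partial i g x)))"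
    using green_radial_weight[OF f g dK K0 k(4)] by simp
  also have "\<dots> = (LINT x|lborel. K (x \<bullet> x) * (f x * laplacian g x) + K (x \<bullet> x) * (\<Sum>i\<in>UNIV. partial i f x * partial i g x))"
    by (simp add: distrib_left)
  also have "\<dots> = (LINT x|lborel. K (x \<bullet> x) * (f x * laplacian g x)) +
      (LINT x|lborel. K (x \<bullet> x) * (\<Sum>i\<in>UNIV. partial i f x * partial i g x))"
    by (rule Bochner_Integration.integral_add[OF i1 i2])
  finally show ?thesis by (simp add: K_def Tl_def mult_ac)
qed

text \<open>Multiplying the equation by f_i and integrating replaces |f|^(p-1) f_i^2 by I2 - (a + b)
  I1 + a b I0, with I2, I1, I0 the weighted integrals of (T f_i)^2, f_i T f_i and f_i^2. Stability
  thus becomes an inequality between quadratic expressions, in which the I2 and I1 terms have a sign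
  that allows dropping them.\<close>

lemma energy_inequality:
  fixes u f :: "nat \<Rightarrow> real^'n::finite \<Rightarrow> real" and p a b :: real
  assumes stable: "is_stable m p u" and p: "p > 1"
    and f: "\<And>i. i < m \<Longrightarrow> smooth_on (-{0}) (f i)" "\<And>i. i < m \<Longrightarrow> homog0 (f i)"
    and u: "\<And>i x. i < m \<Longrightarrow> x \<noteq> 0 \<Longrightarrow> u i x = norm x powr (- 4 / (p - 1)) * f i x"
    and eq: "\<And>i x. i < m \<Longrightarrow> x \<noteq> 0 \<Longrightarrow>
      Tl (\<lambda>x. Tl (f i) x - a * f i x) x - b * (Tl (f i) x - a * f i x) = vnorm m f x powr (p - 1) * f i x"
    and \<eta>: "\<And>k. diff_n k UNIV \<eta>" "\<And>t. (\<eta> has_real_derivative \<eta>' t) (at t)"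
      "\<And>t. (\<eta>' has_real_derivative \<eta>'' t) (at t)" "continuous_on UNIV \<eta>''"
      "\<And>t. t \<le> 1 \<Longrightarrow> \<eta> t = 0" "\<And>t. t \<ge> R \<Longrightarrow> \<eta> t = 0" "R \<ge> 1"
  defines "A \<equiv> real CARD('n) * (real CARD('n) - 4) / 4"
    and "e \<equiv> \<lambda>t. 4 * t^2 * \<eta>'' t + 8 * t * \<eta>' t"
    and "w \<equiv> \<lambda>t. t powr (- real CARD('n) / 2)"
  assumes e0: "\<And>t. t \<notin> {1..R} \<Longrightarrow> e t = 0"
    and ab: "p * (a + b) \<ge> 2 * A"
  shows "(p * a * b - A^2) * (\<Sum>i<m. LINT x|lborel. (w (x \<bullet> x) * (\<eta> (x \<bullet> x))^2) * (f i x)^2)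
    \<le> (\<Sum>i<m. LINT x|lborel. w (x \<bullet> x) *
        (2 * \<eta> (x \<bullet> x) * (Tl (f i) x - A * f i x) * (e (x \<bullet> x) * f i x) + (e (x \<bullet> x) * f i x)^2))"
    and "\<And>i. i < m \<Longrightarrow> integrable lborel (\<lambda>x. w (x \<bullet> x) *
        (2 * \<eta> (x \<bullet> x) * (Tl (f i) x - A * f i x) * (e (x \<bullet> x) * f i x) + (e (x \<bullet> x) * f i x)^2))"
proof -
  define k where "k t = w t * (\<eta> t)^2" for t
  define err where "err i x = w (x \<bullet> x) *
        (2 * \<eta> (x \<bullet> x) * (Tl (f i) x - A * f i x) * (e (x \<bullet> x) * f i x) + (e (x \<bullet> x) * f i x)^2)" for i x
  have dk: "diff_n n {0<..} k" for n
    unfolding k_def w_def power2_eq_square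
    by (intro diff_n_mult diff_n_powr diff_n_subset[OF \<eta>(1)] subset_UNIV)
  have ck: "continuous_on {0<..} k" by (rule diff_n_continuous[OF dk])
  have k0: "t \<le> 1 \<Longrightarrow> k t = 0" "t \<ge> R \<Longrightarrow> k t = 0" for t using \<eta>(5,6) by (auto simp: k_def)
  have k0': "k t = 0" if "t \<notin> {1..R}" for t using k0[of t] that by auto
  have kpos: "k t \<ge> 0" for t by (simp add: k_def w_def)
  have c\<eta>: "continuous_on T \<eta>" for T by (rule diff_n_UNIV_continuous[OF \<eta>(1)])
  have c\<eta>': "continuous_on T \<eta>'" for T
    by (rule continuous_on_subset[OF DERIV_continuous_on[of UNIV \<eta>' \<eta>'']]) (use \<eta>(3) in auto)
  have c\<eta>'': "continuous_on T \<eta>''" for T by (rule continuous_on_subset[OF \<eta>(4)]) simp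
  have ce: "continuous_on T e" for T unfolding e_def by (intro continuous_intros c\<eta>' c\<eta>'')
  have cw: "continuous_on {0<..} w" unfolding w_def by (intro continuous_intros) auto
  note T = homog0_Tl[OF f]
  have cf: "i < m \<Longrightarrow> continuous_on (-{0}) (f i)" for i by (rule smooth_on_continuous[OF f(1)])
  have cT: "i < m \<Longrightarrow> continuous_on (-{0}) (Tl (f i))" for i by (rule smooth_on_continuous[OF T(1)])
  have int: "integrable lborel (\<lambda>x. k (x \<bullet> x) * h x)" if "continuous_on (-{0}) h" for h :: "real^'n \<Rightarrow> real"
    by (rule integrable_radial_weight[OF ck]) (erule k0', rule that)
  have parts: "(LINT x|lborel. k (x \<bullet> x) * (h x * Tl g x)) =
      - (LINT x|lborel. (k (x \<bullet> x) * (x \<bullet> x)) * (\<Sum>i\<in>UNIV. partial i h x * partial i g x))"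
    if "smooth_on (-{0}) h" "smooth_on (-{0}) g" "homog0 g" for h g :: "real^'n \<Rightarrow> real"
    by (rule integral_Tl_by_parts[where R=R]) (use that dk k0 \<eta>(7) in auto)
  define I2 where "I2 i = (LINT x|lborel. k (x \<bullet> x) * (Tl (f i) x)^2)" for i
  define I1 where "I1 i = (LINT x|lborel. k (x \<bullet> x) * (f i x * Tl (f i) x))" for i
  define I0 where "I0 i = (LINT x|lborel. k (x \<bullet> x) * (f i x)^2)" for i
  have i2: "integrable lborel (\<lambda>x. k (x \<bullet> x) * (Tl (f i) x)^2)" if "i < m" for i
    by (intro int continuous_intros cT that)
  have i1: "integrable lborel (\<lambda>x. k (x \<bullet> x) * (f i x * Tl (f i) x))" if "i < m" for i
    by (intro int continuous_intros cT cf that)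
  have i0: "integrable lborel (\<lambda>x. k (x \<bullet> x) * (f i x)^2)" if "i < m" for i
    by (intro int continuous_intros cf that)
  have quad: "(LINT x|lborel. c2 * (k (x \<bullet> x) * (Tl (f i) x)^2) + c1 * (k (x \<bullet> x) * (f i x * Tl (f i) x))
      + c0 * (k (x \<bullet> x) * (f i x)^2)) = c2 * I2 i + c1 * I1 i + c0 * I0 i" if "i < m" for i c2 c1 c0
    using i2[OF that] i1[OF that] i0[OF that] by (simp add: I2_def I1_def I0_def)
  have I2pos: "I2 i \<ge> 0" for i unfolding I2_def by (rule Bochner_Integration.integral_nonneg) (simp add: kpos)
  have I1neg: "I1 i \<le> 0" if "i < m" for i
  proof -
    have "(LINT x|lborel. (k (x \<bullet> x) * (x \<bullet> x)) * (\<Sum>j\<in>UNIV. partial j (f i) x * partial j (f i) x)) \<ge> 0"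
      by (rule Bochner_Integration.integral_nonneg) (simp add: kpos sum_nonneg)
    then show ?thesis
      unfolding I1_def parts[OF f(1)[OF that] f(1)[OF that] f(2)[OF that]] by simp
  qed
  have nonlin: "(LINT x|lborel. k (x \<bullet> x) * (vnorm m f x powr (p - 1) * (f i x)^2)) = I2 i - (a + b) * I1 i + a * b * I0 i"
    if "i < m" for i
  proof -
    define g where "g x = Tl (f i) x - a * f i x" for x
    have g: "smooth_on (-{0}) g" "homog0 g"
      unfolding g_def by (rule homog0_diff_const_mult[OF T(1)[OF that that] T(2)[OF that that] f(1)[OF that] f(2)[OF that]])+
    have cg: "continuous_on (-{0}) g" by (rule smooth_on_continuous[OF g(1)])
    have cTg: "continuous_on (-{0}) (Tl g)" by (rule smooth_on_continuous[OF homog0_Tl(1)[OF g]])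
    have "k (x \<bullet> x) * (vnorm m f x powr (p - 1) * (f i x)^2) = k (x \<bullet> x) * (f i x * Tl g x) - b * (k (x \<bullet> x) * (f i x * g x))" for x
    proof (cases "x = 0")
      case True
      then show ?thesis using k0(1)[of 0] by simp
    next
      case False
      have "vnorm m f x powr (p - 1) * f i x = Tl g x - b * g x"
        using eq[OF that False] unfolding g_def[abs_def] by simp
      then have "vnorm m f x powr (p - 1) * (f i x)^2 = (Tl g x - b * g x) * f i x"
        by (metis mult.assoc power2_eq_square)
      then have "k (x \<bullet> x) * (vnorm m f x powr (p - 1) * (f i x)^2) = k (x \<bullet> x) * ((Tl g x - b * g x) * f i x)" by simp
      then show ?thesis by (simp add: algebra_simps)
    qed
    then have "(LINT x|lborel. k (x \<bullet> x) * (vnorm m f x powr (p - 1) * (f i x)^2))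
      = (LINT x|lborel. k (x \<bullet> x) * (f i x * Tl g x) - b * (k (x \<bullet> x) * (f i x * g x)))" by simp
    also have "\<dots> = (LINT x|lborel. k (x \<bullet> x) * (f i x * Tl g x)) - b * (LINT x|lborel. k (x \<bullet> x) * (f i x * g x))"
      using int[OF continuous_on_mult[OF cf[OF that] cTg]] int[OF continuous_on_mult[OF cf[OF that] cg]] by simp
    \<comment> \<open>Symmetry of T: both integrals equal the same gradient integral.\<close>
    also have "(LINT x|lborel. k (x \<bullet> x) * (f i x * Tl g x)) = (LINT x|lborel. k (x \<bullet> x) * (g x * Tl (f i) x))"
      unfolding parts[OF f(1)[OF that] g] parts[OF g(1) f(1)[OF that] f(2)[OF that]] by (simp add: mult.commute)
    also have "(LINT x|lborel. k (x \<bullet> x) * (g x * Tl (f i) x)) = 1 * I2 i + (- a) * I1 i + 0 * I0 i"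
      unfolding quad[OF that, symmetric] by (simp add: g_def power2_eq_square algebra_simps)
    also have "(LINT x|lborel. k (x \<bullet> x) * (f i x * g x)) = 0 * I2 i + 1 * I1 i + (- a) * I0 i"
      unfolding quad[OF that, symmetric] by (simp add: g_def power2_eq_square algebra_simps)
    finally show ?thesis by (simp add: algebra_simps)
  qed
  have ierr: "integrable lborel (err i)" if "i < m" for i
  proof -
    have "integrable lborel (\<lambda>x. (w (x \<bullet> x) * (2 * \<eta> (x \<bullet> x) * e (x \<bullet> x))) * ((Tl (f i) x - A * f i x) * f i x))"
      by (rule integrable_radial_weight[of "\<lambda>t. w t * (2 * \<eta> t * e t)" R])
        (intro continuous_intros cw c\<eta> ce, simp add: e0, intro continuous_intros cT cf that)
    moreover have "integrable lborel (\<lambda>x. (w (x \<bullet> x) * (e (x \<bullet> x))^2) * (f i x)^2)"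
      by (rule integrable_radial_weight[of "\<lambda>t. w t * (e t)^2" R])
        (intro continuous_intros cw ce, simp add: e0, intro continuous_intros cf that)
    ultimately have "integrable lborel (\<lambda>x. (w (x \<bullet> x) * (2 * \<eta> (x \<bullet> x) * e (x \<bullet> x))) * ((Tl (f i) x - A * f i x) * f i x)
      + (w (x \<bullet> x) * (e (x \<bullet> x))^2) * (f i x)^2)" by (rule Bochner_Integration.integrable_add)
    then show ?thesis by (simp add: err_def[abs_def] power2_eq_square algebra_simps)
  qed
  then show "\<And>i. i < m \<Longrightarrow> integrable lborel (\<lambda>x. w (x \<bullet> x) *
        (2 * \<eta> (x \<bullet> x) * (Tl (f i) x - A * f i x) * (e (x \<bullet> x) * f i x) + (e (x \<bullet> x) * f i x)^2))"
    unfolding err_def .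
  have rhs: "(LINT x|lborel. w (x \<bullet> x) * (\<eta> (x \<bullet> x) * (Tl (f i) x - A * f i x) + e (x \<bullet> x) * f i x)^2)
      = I2 i - 2 * A * I1 i + A^2 * I0 i + (LINT x|lborel. err i x)" if "i < m" for i
  proof -
    have "(LINT x|lborel. w (x \<bullet> x) * (\<eta> (x \<bullet> x) * (Tl (f i) x - A * f i x) + e (x \<bullet> x) * f i x)^2)
      = (LINT x|lborel. (1 * (k (x \<bullet> x) * (Tl (f i) x)^2) + (- 2 * A) * (k (x \<bullet> x) * (f i x * Tl (f i) x))
      + A^2 * (k (x \<bullet> x) * (f i x)^2)) + err i x)"
      by (simp add: err_def k_def power2_eq_square algebra_simps)
    also have "\<dots> = (LINT x|lborel. (1 * (k (x \<bullet> x) * (Tl (f i) x)^2) + (- 2 * A) * (k (x \<bullet> x) * (f i x * Tl (f i) x))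
      + A^2 * (k (x \<bullet> x) * (f i x)^2))) + (LINT x|lborel. err i x)"
      using i2[OF that] i1[OF that] i0[OF that] ierr[OF that]
      by (intro Bochner_Integration.integral_add Bochner_Integration.integrable_add integrable_mult_right) auto
    finally show ?thesis unfolding quad[OF that] by simp
  qed
  have "p * (\<Sum>i<m. I2 i - (a + b) * I1 i + a * b * I0 i) \<le> (\<Sum>i<m. I2 i - 2 * A * I1 i + A^2 * I0 i + (LINT x|lborel. err i x))"
  proof -
    have "p * (\<Sum>i<m. LINT x|lborel. (w (x \<bullet> x) * (\<eta> (x \<bullet> x))^2) * (vnorm m f x powr (p - 1) * (f i x)^2))
      \<le> (\<Sum>i<m. LINT x|lborel. w (x \<bullet> x) * (\<eta> (x \<bullet> x) * (Tl (f i) x - A * f i x) + e (x \<bullet> x) * f i x)^2)"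
      unfolding A_def e_def w_def
      by (rule stability_radial_test[where R=R]) (fact stable p f u \<eta>)+
    then show ?thesis unfolding k_def[symmetric] by (simp add: nonlin rhs)
  qed
  then have "(\<Sum>i<m. p * (I2 i - (a + b) * I1 i + a * b * I0 i) - (I2 i - 2 * A * I1 i + A^2 * I0 i)) \<le> (\<Sum>i<m. LINT x|lborel. err i x)"
    unfolding sum_subtractf sum_distrib_left[symmetric]
    by (simp only: sum.distrib[of _ "\<lambda>i. LINT x|lborel. err i x"])
  moreover have "(p * a * b - A^2) * I0 i \<le> p * (I2 i - (a + b) * I1 i + a * b * I0 i) - (I2 i - 2 * A * I1 i + A^2 * I0 i)" if "i < m" for i
  proof -
    have "(p - 1) * I2 i \<ge> 0" using p I2pos by simp
    moreover have "(p * (a + b) - 2 * A) * (- I1 i) \<ge> 0" using ab I1neg[OF that] by (intro mult_nonneg_nonneg) auto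
    ultimately show ?thesis by (simp add: algebra_simps)
  qed
  then have "(\<Sum>i<m. (p * a * b - A^2) * I0 i) \<le> (\<Sum>i<m. p * (I2 i - (a + b) * I1 i + a * b * I0 i) - (I2 i - 2 * A * I1 i + A^2 * I0 i))"
    by (intro sum_mono) auto
  ultimately show "(p * a * b - A^2) * (\<Sum>i<m. LINT x|lborel. (w (x \<bullet> x) * (\<eta> (x \<bullet> x))^2) * (f i x)^2)
    \<le> (\<Sum>i<m. LINT x|lborel. w (x \<bullet> x) *
        (2 * \<eta> (x \<bullet> x) * (Tl (f i) x - A * f i x) * (e (x \<bullet> x) * f i x) + (e (x \<bullet> x) * f i x)^2))"
    unfolding sum_distrib_left I0_def k_def err_def by linarith
qed

text \<open>Both collars contribute \<open>O(1)\<close>, uniformly in \<open>r\<close>, as the weight is homogeneous of degree \<open>-n\<close>.\<close>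
lemma collar_error_bound:
  fixes h f :: "real^'n::finite \<Rightarrow> real" and \<eta> e :: "real \<Rightarrow> real"
  defines "w \<equiv> \<lambda>t. t powr (- real CARD('n) / 2)"
  assumes h: "\<And>x. x \<noteq> 0 \<Longrightarrow> \<bar>h x\<bar> \<le> B1" and f: "\<And>x. x \<noteq> 0 \<Longrightarrow> \<bar>f x\<bar> \<le> B2"
    and \<eta>: "\<And>t. \<bar>\<eta> t\<bar> \<le> 1"
    and e: "\<And>t. \<bar>e t\<bar> \<le> M * (indicator {1..2} t + indicator {r^2..2 * r^2} t)"
    and nn: "B1 \<ge> 0" "B2 \<ge> 0" "M \<ge> 0" "r > 0"
    and int: "integrable lborel (\<lambda>x. w (x \<bullet> x) * (2 * \<eta> (x \<bullet> x) * h x * (e (x \<bullet> x) * f x) + (e (x \<bullet> x) * f x)^2))"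
  shows "(LINT x|lborel. w (x \<bullet> x) * (2 * \<eta> (x \<bullet> x) * h x * (e (x \<bullet> x) * f x) + (e (x \<bullet> x) * f x)^2))
    \<le> (2 * B1 * B2 * M + 2 * M^2 * B2^2) * (2 * unit_ball_vol (real CARD('n)) * sqrt 2 ^ CARD('n))"
proof -
  let ?n = "CARD('n)"
  define C where "C = 2 * B1 * B2 * M + 2 * M^2 * B2^2"
  have C: "C \<ge> 0" using nn by (simp add: C_def)
  \<comment> \<open>The value 2 occurs where the two intervals overlap. Hence J^2 <= 2 J, the source
    of the factor 2 in front of M^2.\<close>
  define J where "J t = (indicator {1..2} t + indicator {r^2..2 * r^2} t :: real)" for t
  have J: "0 \<le> J t" "J t \<le> 2" for t by (auto simp: J_def indicator_def)
  \<comment> \<open>The collars are enlarged to full balls, with |x|^(-n) at most 1 on the inner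
    collar and at most r^(-n) on the outer one. The factor r^(-n) cancels the growth of the volume,
    so the bound is free of r.\<close>
  define L where "L x = C * (indicator (cball 0 (sqrt 2)) x + 1 / r ^ ?n * indicator (cball 0 (sqrt 2 * r)) x)" for x :: "real^'n"
  have ic: "integrable lborel (indicator (cball (0::real^'n) s) :: _ \<Rightarrow> real)" for s
    by (intro integrable_real_indicator) (simp_all add: emeasure_bounded_finite[OF bounded_cball, unfolded infinity_ennreal_def])
  have iL: "integrable lborel L"
    unfolding L_def by (intro integrable_mult_right Bochner_Integration.integrable_add ic)
  have "(LINT x|lborel. L x) = C * (measure lborel (cball (0::real^'n) (sqrt 2)) + 1 / r ^ ?n * measure lborel (cball (0::real^'n) (sqrt 2 * r)))"
    unfolding L_def using ic by simp
  also have "\<dots> = C * (2 * unit_ball_vol (real ?n) * sqrt 2 ^ ?n)"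
    using nn(4) by (simp add: measure_cball_scale power_mult_distrib field_simps)
  finally have IL: "(LINT x|lborel. L x) = C * (2 * unit_ball_vol (real ?n) * sqrt 2 ^ ?n)" .
  have "w (x \<bullet> x) * (2 * \<eta> (x \<bullet> x) * h x * (e (x \<bullet> x) * f x) + (e (x \<bullet> x) * f x)^2) \<le> L x" for x
  proof (cases "x = 0")
    case True
    then show ?thesis using C nn by (simp add: w_def L_def)
  next
    case False
    define t where "t = x \<bullet> x"
    have w0: "w t \<ge> 0" by (simp add: w_def)
    have "2 * \<eta> t * h x * (e t * f x) \<le> \<bar>2 * \<eta> t * h x * (e t * f x)\<bar>" by (rule abs_ge_self)
    also have "\<dots> = 2 * \<bar>\<eta> t\<bar> * \<bar>h x\<bar> * (\<bar>e t\<bar> * \<bar>f x\<bar>)" by (simp add: abs_mult)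
    also have "\<dots> \<le> 2 * 1 * B1 * ((M * J t) * B2)"
      using \<eta>[of t] h[OF False] e[of t] f[OF False] nn J(1)[of t] unfolding J_def[symmetric]
      by (intro mult_mono mult_nonneg_nonneg) auto
    finally have 1: "2 * \<eta> t * h x * (e t * f x) \<le> 2 * B1 * B2 * M * J t" by (simp add: mult_ac)
    have "\<bar>e t * f x\<bar> \<le> (M * J t) * B2"
      unfolding abs_mult using e[of t] f[OF False] nn J(1)[of t] unfolding J_def[symmetric]
      by (intro mult_mono) auto
    then have "(e t * f x)^2 \<le> ((M * J t) * B2)^2" by (rule power2_le_iff_abs_le[THEN iffD2, rotated]) (use nn J(1)[of t] in auto)
    also have "\<dots> = M^2 * B2^2 * (J t * J t)" by (simp add: power2_eq_square mult_ac)
    also have "\<dots> \<le> M^2 * B2^2 * (2 * J t)" using J[of t] by (intro mult_left_mono mult_right_mono) auto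
    finally have "2 * \<eta> t * h x * (e t * f x) + (e t * f x)^2 \<le> C * J t"
      using 1 by (simp add: C_def algebra_simps)
    then have "w t * (2 * \<eta> t * h x * (e t * f x) + (e t * f x)^2) \<le> w t * (C * J t)"
      using w0 by (rule mult_left_mono)
    also have "\<dots> = C * (w t * indicator {1..2} t + w t * indicator {r^2..2 * r^2} t)"
      by (simp add: J_def algebra_simps)
    also have "\<dots> \<le> L x" unfolding L_def
    proof (intro mult_left_mono C add_mono)
      have wt: "w t = 1 / norm x ^ ?n" unfolding w_def t_def by (rule radial_weight_power[OF False])
      have sq: "norm x \<le> sqrt s" if "t \<le> s" for s
        using that by (simp add: norm_eq_sqrt_inner t_def)
      show "w t * indicator {1..2} t \<le> indicator (cball 0 (sqrt 2)) x"
      proof (cases "t \<in> {1..2}")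
        case True
        then have "norm x \<ge> 1" by (simp add: norm_eq_sqrt_inner t_def)
        then have "1 \<le> norm x ^ ?n" by (rule one_le_power)
        then have "w t \<le> 1" unfolding wt by (subst divide_le_eq_1_pos) auto
        then show ?thesis using True sq[of 2] by simp
      qed simp
      show "w t * indicator {r^2..2 * r^2} t \<le> 1 / r ^ ?n * indicator (cball 0 (sqrt 2 * r)) x"
      proof (cases "t \<in> {r^2..2 * r^2}")
        case True
        then have "r \<le> norm x" using nn(4) by (simp add: norm_eq_sqrt_inner t_def real_le_rsqrt)
        then have "r ^ ?n \<le> norm x ^ ?n" using nn(4) by (intro power_mono) auto
        then have "w t \<le> 1 / r ^ ?n" unfolding wt using nn(4) False by (intro divide_left_mono) auto
        moreover have "norm x \<le> sqrt 2 * r" using sq[of "2 * r^2"] True nn(4) by (simp add: real_sqrt_mult)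
        ultimately show ?thesis using True by simp
      qed (use nn(4) in simp)
    qed
    finally show ?thesis by (simp add: t_def)
  qed
  then have "(LINT x|lborel. w (x \<bullet> x) * (2 * \<eta> (x \<bullet> x) * h x * (e (x \<bullet> x) * f x) + (e (x \<bullet> x) * f x)^2)) \<le> (LINT x|lborel. L x)"
    by (intro integral_mono int iL)
  then show ?thesis unfolding IL C_def .
qed

text \<open>The cutoff is \<open>\<sigma>(t) - \<sigma>(t / r\<^sup>2)\<close> with \<open>t = |x|\<^sup>2\<close>: a plateau of logarithmic length about \<open>2 log r\<close>
  between two collars that are dilates of one another.\<close>
lemma homogeneous_stable_zero:
  fixes u f :: "nat \<Rightarrow> real^'n::finite \<Rightarrow> real" and p a b :: real
  assumes stable: "is_stable m p u" and p: "p > 1"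
    and f: "\<And>i. i < m \<Longrightarrow> smooth_on (-{0}) (f i)" "\<And>i. i < m \<Longrightarrow> homog0 (f i)"
    and u: "\<And>i x. i < m \<Longrightarrow> x \<noteq> 0 \<Longrightarrow> u i x = norm x powr (- 4 / (p - 1)) * f i x"
    and eq: "\<And>i x. i < m \<Longrightarrow> x \<noteq> 0 \<Longrightarrow>
      Tl (\<lambda>x. Tl (f i) x - a * f i x) x - b * (Tl (f i) x - a * f i x) = vnorm m f x powr (p - 1) * f i x"
  defines "A \<equiv> real CARD('n) * (real CARD('n) - 4) / 4"
  assumes ab: "p * (a + b) \<ge> 2 * A" "p * a * b > A^2"
    and i: "i < m" and \<theta>: "norm \<theta> = 1"
  shows "f i \<theta> = 0"
proof (rule ccontr)
  assume "f i \<theta> \<noteq> 0"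
  define w where "w t = t powr (- real CARD('n) / 2)" for t :: real
  obtain \<sigma> \<sigma>' \<sigma>'' where st: "smooth_step \<sigma> \<sigma>' \<sigma>''" using smooth_step_exists by blast
  note \<sigma> = smooth_stepD[OF st]
  \<comment> \<open>The cutoff error of the fixed profile \<open>\<sigma>\<close>; its bound M is
    found before any r is chosen.\<close>
  define E where "E s = 4 * s^2 * \<sigma>'' s + 8 * s * \<sigma>' s" for s
  have cs': "continuous_on UNIV \<sigma>'" by (rule DERIV_continuous_on[of UNIV \<sigma>' \<sigma>'']) (use \<sigma>(3) in auto)
  have "continuous_on {1..2} E"
    unfolding E_def by (intro continuous_intros continuous_on_subset[OF \<sigma>(4)] continuous_on_subset[OF cs']) auto
  then have "compact (E ` {1..2})" by (intro compact_continuous_image) auto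
  then obtain M where "\<forall>y\<in>E ` {1..2}. norm y \<le> M"
    using compact_imp_bounded[of "E ` {1..2}"] unfolding bounded_iff by blast
  then have M: "\<bar>E s\<bar> \<le> M" if "s \<in> {1..2}" for s using that by auto
  have M0: "M \<ge> 0" using M[of 1] by simp
  have E0: "E s = 0" if "s \<notin> {1..2}" for s using \<sigma>(8)[OF that] by (simp add: E_def)
  have EM: "\<bar>E s\<bar> \<le> M * indicator {1..2} s" for s using M E0 by (auto simp: indicator_def)
  have "\<forall>j\<in>{..<m}. \<exists>B. \<forall>x. x \<noteq> 0 \<longrightarrow> \<bar>f j x\<bar> \<le> B \<and> \<bar>Tl (f j) x - A * f j x\<bar> \<le> B"
  proof
    fix j assume "j \<in> {..<m}"
    then have j: "j < m" by simp
    note T = homog0_Tl[OF f(1)[OF j] f(2)[OF j]]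
    note D = homog0_diff_const_mult[OF T f(1)[OF j] f(2)[OF j], of A]
    obtain B1 where "B1 \<ge> 0" "\<And>x. x \<noteq> 0 \<Longrightarrow> \<bar>f j x\<bar> \<le> B1"
      using homog0_bounded[OF smooth_on_continuous[OF f(1)[OF j]] f(2)[OF j]] by blast
    moreover obtain B2 where "B2 \<ge> 0" "\<And>x. x \<noteq> 0 \<Longrightarrow> \<bar>Tl (f j) x - A * f j x\<bar> \<le> B2"
      using homog0_bounded[OF smooth_on_continuous[OF D(1)] D(2)] by blast
    ultimately show "\<exists>B. \<forall>x. x \<noteq> 0 \<longrightarrow> \<bar>f j x\<bar> \<le> B \<and> \<bar>Tl (f j) x - A * f j x\<bar> \<le> B"
      by (intro exI[of _ "max B1 B2"]) (auto simp: le_max_iff_disj)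
  qed
  from bchoice[OF this] obtain B where
    "\<forall>j\<in>{..<m}. \<forall>x. x \<noteq> 0 \<longrightarrow> \<bar>f j x\<bar> \<le> B j \<and> \<bar>Tl (f j) x - A * f j x\<bar> \<le> B j" ..
  then have B: "\<And>j x. j < m \<Longrightarrow> x \<noteq> 0 \<Longrightarrow> \<bar>f j x\<bar> \<le> B j"
      "\<And>j x. j < m \<Longrightarrow> x \<noteq> 0 \<Longrightarrow> \<bar>Tl (f j) x - A * f j x\<bar> \<le> B j"
    by auto
  have \<theta>0: "\<theta> \<noteq> 0" using \<theta> by auto
  have B0: "B j \<ge> 0" if "j < m" for j using B(1)[OF that \<theta>0] by linarith
  obtain \<kappa> where \<kappa>: "\<kappa> > 0" "\<forall>J k R. continuous_on {0<..} k \<longrightarrow> (\<forall>t. t \<notin> {1..R} \<longrightarrow> k t = 0) \<longrightarrow>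
      (\<forall>t. k t \<ge> 0) \<longrightarrow> (\<forall>t. 2 \<le> t \<and> t \<le> (4 ^ Suc J)^2 \<longrightarrow> k t = t powr (- real CARD('n) / 2)) \<longrightarrow>
      \<kappa> * real J \<le> (LINT x|lborel. k (x \<bullet> x) * (f i x)^2)"
    using weighted_mass_unbounded[OF smooth_on_continuous[OF f(1)[OF i]] f(2)[OF i] \<theta> \<open>f i \<theta> \<noteq> 0\<close>] by blast
  \<comment> \<open>Built from bounds on the f_j and on \<open>\<sigma>\<close>, so that one
    constant serves every J.\<close>
  define C where "C = (\<Sum>j<m. (2 * B j * B j * M + 2 * M^2 * (B j)^2) * (2 * unit_ball_vol (real CARD('n)) * sqrt 2 ^ CARD('n)))"
  have bound: "(p * a * b - A^2) * (\<kappa> * real J) \<le> C" for J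
  proof -
    \<comment> \<open>With this r the plateau 2 <= t <= r^2 contains the J shells of
      \<open>weighted_mass_unbounded\<close>, and N = r^2 >= 16 separates the two collars.\<close>
    define r :: real where "r = 4 ^ Suc J"
    define N where "N = r^2"
    have r: "r \<ge> 4" unfolding r_def using power_increasing[of 1 "Suc J" "4::real"] by simp
    then have N: "N \<ge> 16" unfolding N_def using power_mono[of 4 r 2] by simp
    define \<eta> where "\<eta> t = \<sigma> t - \<sigma> (t / N)" for t
    define \<eta>' where "\<eta>' t = \<sigma>' t - \<sigma>' (t / N) * (1 / N)" for t
    define \<eta>'' where "\<eta>'' t = \<sigma>'' t - \<sigma>'' (t / N) * (1 / N) * (1 / N)" for t
    define e where "e t = 4 * t^2 * \<eta>'' t + 8 * t * \<eta>' t" for t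
    have tN: "((\<lambda>t. t / N) has_real_derivative 1 / N) (at t)" for t
      using N by (auto intro!: derivative_eq_intros)
    have d0: "diff_n k UNIV \<eta>" for k
      unfolding \<eta>_def using diff_n_add[OF \<sigma>(1) diff_n_mult[OF diff_n_const[of k UNIV "-1"] diff_n_affine[OF \<sigma>(1), of k "1 / N" 0]]]
      by simp
    have d1: "(\<eta> has_real_derivative \<eta>' t) (at t)" for t
      unfolding \<eta>_def \<eta>'_def by (intro DERIV_diff \<sigma>(2) DERIV_chain2[OF \<sigma>(2) tN])
    have d2: "(\<eta>' has_real_derivative \<eta>'' t) (at t)" for t
      unfolding \<eta>'_def \<eta>''_def by (intro DERIV_diff \<sigma>(3) DERIV_cmult_right DERIV_chain2[OF \<sigma>(3) tN])
    have c2: "continuous_on UNIV \<eta>''"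
      unfolding \<eta>''_def by (intro continuous_intros \<sigma>(4) continuous_on_compose2[OF \<sigma>(4)]) (use N in auto)
    have z1: "\<eta> t = 0" if "t \<le> 1" for t
    proof -
      have "t / N \<le> 1" using that N by (simp add: field_simps)
      then show ?thesis using that \<sigma>(5) by (simp add: \<eta>_def)
    qed
    have z2: "\<eta> t = 0" if "t \<ge> 2 * N" for t
    proof -
      have "t / N \<ge> 2" "t \<ge> 2" using that N by (auto simp: field_simps)
      then show ?thesis using \<sigma>(6) by (simp add: \<eta>_def)
    qed
    \<comment> \<open>The operator 4 t^2 d^2/dt^2 + 8 t d/dt commutes with dilations of t, so the
      outer collar repeats the error profile of the inner one and obeys the same bound M.\<close>
    have eE: "e t = E t - E (t / N)" for t
      using N by (simp add: e_def E_def \<eta>'_def \<eta>''_def field_simps power2_eq_square)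
    have sc: "t / N \<in> {1..2} \<longleftrightarrow> t \<in> {N..2 * N}" for t
      using N by (auto simp: field_simps)
    have eM: "\<bar>e t\<bar> \<le> M * (indicator {1..2} t + indicator {r^2..2 * r^2} t)" for t
    proof -
      have "indicator {1..2} (t / N) = (indicator {N..2 * N} t :: real)"
        using sc[of t] by (simp add: indicator_def)
      then have "\<bar>e t\<bar> \<le> M * indicator {1..2} t + M * indicator {N..2 * N} t"
        using EM[of t] EM[of "t / N"] abs_triangle_ineq4[of "E t" "E (t / N)"] unfolding eE by simp
      then show ?thesis by (simp add: N_def distrib_left)
    qed
    have e0: "e t = 0" if "t \<notin> {1..2 * N}" for t
    proof -
      have "t \<notin> {1..2}" "t \<notin> {N..2 * N}" using that N by auto
      then have "E t = 0" "E (t / N) = 0" using E0[of t] E0[of "t / N"] sc[of t] by blast+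
      then show ?thesis by (simp add: eE)
    qed
    have \<eta>1: "\<bar>\<eta> t\<bar> \<le> 1" for t using \<sigma>(7)[of t] \<sigma>(7)[of "t / N"] by (auto simp: \<eta>_def)
    have R1: "2 * N \<ge> 1" using N by simp
    note hyps = stable p f u eq d0 d1 d2 c2 z1 z2 R1 e0[unfolded e_def] ab(1)[unfolded A_def]
    have sum: "(p * a * b - A^2) * (\<Sum>i<m. LINT x|lborel. (w (x \<bullet> x) * (\<eta> (x \<bullet> x))^2) * (f i x)^2)
      \<le> (\<Sum>i<m. LINT x|lborel. w (x \<bullet> x) *
        (2 * \<eta> (x \<bullet> x) * (Tl (f i) x - A * f i x) * (e (x \<bullet> x) * f i x) + (e (x \<bullet> x) * f i x)^2))"
      unfolding e_def w_def A_def
      by (rule energy_inequality(1)[where R="2 * N" and a=a and b=b]) (fact hyps)+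
    have err_int: "integrable lborel (\<lambda>x. w (x \<bullet> x) *
        (2 * \<eta> (x \<bullet> x) * (Tl (f j) x - A * f j x) * (e (x \<bullet> x) * f j x) + (e (x \<bullet> x) * f j x)^2))" if "j < m" for j
      unfolding e_def w_def A_def
      by (rule energy_inequality(2)[where R="2 * N" and a=a and b=b]) (fact hyps that)+
    note sum
    also have "(\<Sum>i<m. LINT x|lborel. w (x \<bullet> x) *
        (2 * \<eta> (x \<bullet> x) * (Tl (f i) x - A * f i x) * (e (x \<bullet> x) * f i x) + (e (x \<bullet> x) * f i x)^2)) \<le> C" unfolding C_def
    proof (rule sum_mono)
      fix j assume "j \<in> {..<m}"
      then have j: "j < m" by simp
      show "(LINT x|lborel. w (x \<bullet> x) *
        (2 * \<eta> (x \<bullet> x) * (Tl (f j) x - A * f j x) * (e (x \<bullet> x) * f j x) + (e (x \<bullet> x) * f j x)^2))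
        \<le> (2 * B j * B j * M + 2 * M^2 * (B j)^2) * (2 * unit_ball_vol (real CARD('n)) * sqrt 2 ^ CARD('n))"
        unfolding w_def
        by (rule collar_error_bound[where r=r]) (use B j \<eta>1 eM B0[OF j] M0 r err_int[OF j] in \<open>auto simp: w_def\<close>)
    qed
    finally have tot: "(p * a * b - A^2) * (\<Sum>i<m. LINT x|lborel. (w (x \<bullet> x) * (\<eta> (x \<bullet> x))^2) * (f i x)^2) \<le> C" .
    have wpos: "w t * (\<eta> t)^2 \<ge> 0" for t by (simp add: w_def)
    have "\<kappa> * real J \<le> (LINT x|lborel. (w (x \<bullet> x) * (\<eta> (x \<bullet> x))^2) * (f i x)^2)"
    proof (rule \<kappa>(2)[rule_format, where k="\<lambda>t. w t * (\<eta> t)^2" and R="2 * N"])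
      show "continuous_on {0<..} (\<lambda>t. w t * (\<eta> t)^2)"
        unfolding w_def by (intro continuous_intros diff_n_UNIV_continuous[OF d0]) auto
      show "w t * (\<eta> t)^2 = 0" if "t \<notin> {1..2 * N}" for t
        using that z1[of t] z2[of t] by auto
      show "w t * (\<eta> t)^2 = t powr (- real CARD('n) / 2)" if t: "2 \<le> t \<and> t \<le> (4 ^ Suc J)^2" for t
      proof -
        have "t / N \<le> 1" using t N unfolding N_def r_def by (simp add: field_simps)
        then have "\<eta> t = 1" using \<sigma>(5,6) t by (simp add: \<eta>_def)
        then show ?thesis by (simp add: w_def)
      qed
    qed (rule wpos)
    \<comment> \<open>The other components only add nonnegative mass, so a single nonzero f_i
      already forces growth.\<close>
    also have "\<dots> \<le> (\<Sum>i<m. LINT x|lborel. (w (x \<bullet> x) * (\<eta> (x \<bullet> x))^2) * (f i x)^2)"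
      by (rule member_le_sum) (use i wpos in \<open>auto intro!: Bochner_Integration.integral_nonneg mult_nonneg_nonneg\<close>)
    finally have "(p * a * b - A^2) * (\<kappa> * real J)
      \<le> (p * a * b - A^2) * (\<Sum>i<m. LINT x|lborel. (w (x \<bullet> x) * (\<eta> (x \<bullet> x))^2) * (f i x)^2)"
      by (rule mult_left_mono) (use ab(2) in simp)
    then show ?thesis using tot by (rule order_trans)
  qed
  have pos: "(p * a * b - A^2) * \<kappa> > 0" using ab(2) \<kappa>(1) by simp
  obtain J :: nat where "C < real J * ((p * a * b - A^2) * \<kappa>)"
    using reals_Archimedean3[OF pos] by blast
  with bound[of J] show False by (simp add: mult_ac)
qed

section \<open>From the solution to its angular factors\<close>

theorem theorem3p4:
  fixes m :: nat and p :: real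
    and u \<psi> :: "nat \<Rightarrow> real^'n::finite \<Rightarrow> real"
  assumes "CARD('n) \<ge> 5" and "m \<ge> 1"
    and "\<And>i x. i < m \<Longrightarrow> x \<noteq> 0 \<Longrightarrow>
           u i x = norm x powr (- 4 / (p - 1)) * \<psi> i ((1 / norm x) *\<^sub>R x)"
    and "\<And>i. i < m \<Longrightarrow> smooth_on_sphere (\<psi> i)"
    and "is_solution m p u"
    and "is_stable m p u"
    and "(real CARD('n) + 4) / (real CARD('n) - 4) < p"
    and "ereal p < pc_bar CARD('n)"
  shows "\<forall>i<m. \<forall>\<theta>. norm \<theta> = 1 \<longrightarrow> \<psi> i \<theta> = 0"
proof (intro allI impI)
  fix i and \<theta> :: "real^'n" assume i: "i < m" and \<theta>: "norm \<theta> = 1"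
  \<comment> \<open>The 0-homogeneous extension: \<open>smooth_on_sphere\<close> is precisely its
    smoothness off the origin, and on the unit sphere it equals \<open>\<psi> i\<close>.\<close>
  define f where "f i x = \<psi> i ((1 / norm x) *\<^sub>R x)" for i x
  define \<alpha> where "\<alpha> = 4 / (p - 1)"
  define a where "a = \<alpha> * (real CARD('n) - 2 - \<alpha>)"
  define b where "b = (\<alpha> + 2) * (real CARD('n) - 4 - \<alpha>)"
  note coef = subcritical_coefficients[OF assms(1,7,8), folded \<alpha>_def, folded a_def b_def]
  have p: "p > 1" by (rule coef(1))
  have f: "smooth_on (-{0}) (f j)" "homog0 (f j)" if "j < m" for j
    using assms(4)[OF that] by (auto simp: smooth_on_sphere_def f_def[abs_def] homog0_def)
  have u: "u j x = norm x powr (- 4 / (p - 1)) * f j x" if "j < m" "x \<noteq> 0" for j x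
    unfolding f_def by (rule assms(3)[OF that])
  have u': "u j x = norm x powr (- \<alpha>) * f j x" if "j < m" "x \<noteq> 0" for j x
    using u[OF that] by (simp add: \<alpha>_def)
  have eq: "Tl (\<lambda>x. Tl (f j) x - a * f j x) x - b * (Tl (f j) x - a * f j x) = vnorm m f x powr (p - 1) * f j x"
    if j: "j < m" and x: "x \<noteq> 0" for j x
  proof -
    have nz: "norm x powr (- \<alpha> - 4) \<noteq> 0" using x by simp
    \<comment> \<open>Equivalently \<alpha> p = \<alpha> + 4: the nonlinearity and the bilaplacian
      have the same degree, so the power of |x| cancels from the equation.\<close>
    have "\<alpha> * (p - 1) = 4" using nonzero_eq_divide_eq[of "p - 1" \<alpha> 4] p \<alpha>_def by simp
    then have e4: "- \<alpha> * (p - 1) = - 4" by simp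
    have "vnorm m u x = norm x powr (- \<alpha>) * vnorm m f x"
      by (rule vnorm_scale) (use u' x in auto)
    then have "vnorm m u x powr (p - 1) = norm x powr (- 4) * vnorm m f x powr (p - 1)"
      by (simp only: powr_mult powr_powr e4 vnorm_nonneg powr_ge_zero)
    moreover have "bilaplacian (u j) x = vnorm m u x powr (p - 1) * u j x"
      using assms(5) j x unfolding is_solution_def by blast
    moreover have "norm x powr (- \<alpha> - 4) = norm x powr (- 4) * norm x powr (- \<alpha>)"
      using powr_add[of "norm x" "- 4" "- \<alpha>"] by (simp add: add.commute)
    ultimately have "norm x powr (- \<alpha> - 4) * (Tl (\<lambda>x. Tl (f j) x - a * f j x) x - b * (Tl (f j) x - a * f j x))
        = norm x powr (- \<alpha> - 4) * (vnorm m f x powr (p - 1) * f j x)"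
      using sphere_equation[OF f[OF j] u'[OF j] x] unfolding a_def[symmetric] b_def[symmetric] u'[OF j x]
      by (simp add: mult_ac)
    then show ?thesis using nz by simp
  qed
  have "f i \<theta> = 0"
    by (rule homogeneous_stable_zero[OF assms(6) p f u eq coef(3) coef(2) i \<theta>])
  then show "\<psi> i \<theta> = 0" using \<theta> by (simp add: f_def)
qed

end
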